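(* There is an algorithm (called LocalImprove) that takes as input an undirected graph $G=(V,E)$, a set $A\subset V$ with $0<\mathrm{vol}(A)\le \mathrm{vol}(V-A)$, and a constant $\sigma\in(0,1]$ satisfying $\frac{\mathrm{vol}(V-A)}{\mathrm{vol}(A)}\ge 3\left(\frac1\sigma-1\right)$, and that has the following guarantee. Suppose there exists a set $S^*\subseteq V$ (not known to the algorithm) satisfying $\mathrm{vol}(S^* )\le \mathrm{vol}(V-S^* )$ and $\frac{\mathrm{vol}(A\cap S^* )}{\mathrm{vol}(S^* )}=\delta\ge\sigma$. Then the algorithm outputs a set $S$ satisfying $$\mathrm{vol}(S)\le \frac{3}{\sigma}\,\mathrm{vol}(A)\qquad\text{and}\qquad \phi(S)\le\frac{4}{\delta}\,\phi(S^* )$$ in time $$O\left(\frac{\mathrm{vol}(A)}{\sigma\,\phi(S)}\log^2\left(\frac{\mathrm{vol}(A)}{\sigma}\right)\right).$$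
   Context: $G=(V,E)$ is a finite undirected unweighted graph. For $S\subseteq V$, $\mathrm{vol}(S)=\sum_{v\in S}\deg(v)$; $E(S,T)$ is the set of edges between $S$ and $T$; $V-S$ is the complement of $S$. The conductance of $S$ is $\phi(S)=\frac{|E(S,V-S)|}{\min\{\mathrm{vol}(S),\mathrm{vol}(V-S)\}}$. Ratios with denominator $\mathrm{vol}(S^* )$ are considered only for $\mathrm{vol}(S^* )>0$. Computation model: the algorithm accesses $G$ locally via adjacency lists (and degree queries), $A$ is given as a list of vertices, and running time is on a unit-cost RAM in which an arithmetic operation on the (rational) quantities involved costs $O(1)$; the constants hidden in $O(\cdot)$ are absolute. In running-time bounds a factor $\log x$ is read as $\max\{1,\log x\}$, and the bound is read as $+\infty$ if $\phi(S)=0$.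
   Formalization: The running-time bound has an added term, the number of isolated (degree-0) vertices in A; without it the bound fails when A's list starts with many isolated vertices. If A has no isolated vertices, it is exactly the stated bound. *)

theory Defs
  imports Complex_Main "HOL-Library.Monad_Syntax"
begin

section \<open>Graphs, volume and conductance\<close>

definition simple_graph :: "'a set \<Rightarrow> 'a set set \<Rightarrow> bool" where
  "simple_graph V E \<longleftrightarrow> finite V \<and> (\<forall>e\<in>E. \<exists>u\<in>V. \<exists>v\<in>V. u \<noteq> v \<and> e = {u, v})"

definition degree :: "'a set set \<Rightarrow> 'a \<Rightarrow> nat" where
  "degree E v = card {e \<in> E. v \<in> e}"

definition vol :: "'a set set \<Rightarrow> 'a set \<Rightarrow> nat" where
  "vol E S = (\<Sum>v\<in>S. degree E v)"

definition edges_between :: "'a set set \<Rightarrow> 'a set \<Rightarrow> 'a set \<Rightarrow> 'a set set" where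
  "edges_between E S T = {e \<in> E. \<exists>u\<in>S. \<exists>v\<in>T. e = {u, v}}"

text \<open>
  If the denominator is zero, the quotient below is 0 by the convention of HOL, whereas the
  conductance is really undefined. A statement about the conductance of a set that is not given
  in advance therefore has to say that both volumes are positive.
\<close>

definition conductance :: "'a set \<Rightarrow> 'a set set \<Rightarrow> 'a set \<Rightarrow> real" where
  "conductance V E S =
     real (card (edges_between E S (V - S))) / real (min (vol E S) (vol E (V - S)))"

text \<open>The neighbours of a vertex are listed in an arbitrary order; there is no list for a
  non-vertex.\<close>

definition adjacency_lists :: "'a set \<Rightarrow> 'a set set \<Rightarrow> ('a \<Rightarrow> 'a list option) \<Rightarrow> bool" where
  "adjacency_lists V E adj \<longleftrightarrow>
     dom adj = V \<and> (\<forall>v xs. adj v = Some xs \<longrightarrow> distinct xs \<and> set xs = {u. {u, v} \<in> E})"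


section \<open>A unit-cost RAM with local access to a graph\<close>

text \<open>
  Programs are written in a structured language. A program has finitely many scalar variables and
  finitely many unbounded arrays, indexed by natural numbers; a RAM with a single memory simulates
  them with constant overhead by interleaving the arrays. Every cell holds one number, on which the
  four arithmetic operations and comparisons are available (there is no rounding operation). Only
  rational constants occur in programs, so if the input consists of rational numbers then all
  numbers in a computation are rational; cells are of type real only in order that an arbitrary
  real parameter can be passed to a program.

  Vertices are natural numbers. The graph can be accessed only by
  \<open>Deg v\<close>, the degree of v, and \<open>Nbr v i\<close>, the i-th entry (from 0) of the adjacency list of v.
\<close>

type_synonym vname = string

datatype exp =
    Const rat
  | Var vname
  | Elem vname exp
  | Deg exp
  | Nbr exp exp
  | Plus exp exp
  | Minus exp exp
  | Times exp exp
  | Divide exp exp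

datatype bexp =
    Less exp exp
  | Equal exp exp
  | Not bexp
  | And bexp bexp

datatype com =
    Skip
  | Assign vname exp
  | Store vname exp exp  \<comment> \<open>array, index, value\<close>
  | Seq com com
  | If bexp com com
  | While bexp com

record state =
  vars :: "vname \<Rightarrow> real"
  arrs :: "vname \<Rightarrow> nat \<Rightarrow> real"

text \<open>
  \<open>None\<close> is a fault: an array index or vertex name that is not a natural number, a query about a
  non-vertex or beyond the end of an adjacency list, or a division by zero. A faulting program has
  no execution in the relation \<open>exec\<close> below.
\<close>

definition nat_of :: "real \<Rightarrow> nat option" where
  "nat_of x = (if x \<in> \<nat> then Some (nat \<lfloor>x\<rfloor>) else None)"

primrec eval :: "(nat \<Rightarrow> nat list option) \<Rightarrow> state \<Rightarrow> exp \<Rightarrow> real option" where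
  "eval adj s (Const c) = Some (of_rat c)"
| "eval adj s (Var x) = Some (vars s x)"
| "eval adj s (Elem a e) = do { x \<leftarrow> eval adj s e; i \<leftarrow> nat_of x; Some (arrs s a i) }"
| "eval adj s (Deg e) =
     do { x \<leftarrow> eval adj s e; v \<leftarrow> nat_of x; ns \<leftarrow> adj v; Some (real (length ns)) }"
| "eval adj s (Nbr e e') =
     do { x \<leftarrow> eval adj s e; v \<leftarrow> nat_of x; ns \<leftarrow> adj v; y \<leftarrow> eval adj s e'; i \<leftarrow> nat_of y;
          if i < length ns then Some (real (ns ! i)) else None }"
| "eval adj s (Plus e e') = do { x \<leftarrow> eval adj s e; y \<leftarrow> eval adj s e'; Some (x + y) }"
| "eval adj s (Minus e e') = do { x \<leftarrow> eval adj s e; y \<leftarrow> eval adj s e'; Some (x - y) }"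
| "eval adj s (Times e e') = do { x \<leftarrow> eval adj s e; y \<leftarrow> eval adj s e'; Some (x * y) }"
| "eval adj s (Divide e e') =
     do { x \<leftarrow> eval adj s e; y \<leftarrow> eval adj s e'; if y = 0 then None else Some (x / y) }"

primrec beval :: "(nat \<Rightarrow> nat list option) \<Rightarrow> state \<Rightarrow> bexp \<Rightarrow> bool option" where
  "beval adj s (Less e e') = do { x \<leftarrow> eval adj s e; y \<leftarrow> eval adj s e'; Some (x < y) }"
| "beval adj s (Equal e e') = do { x \<leftarrow> eval adj s e; y \<leftarrow> eval adj s e'; Some (x = y) }"
| "beval adj s (Not b) = do { p \<leftarrow> beval adj s b; Some (\<not> p) }"
| "beval adj s (And b b') = do { p \<leftarrow> beval adj s b; q \<leftarrow> beval adj s b'; Some (p \<and> q) }"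

primrec cost :: "exp \<Rightarrow> nat" where
  "cost (Const c) = 1"
| "cost (Var x) = 1"
| "cost (Elem a e) = 1 + cost e"
| "cost (Deg e) = 1 + cost e"
| "cost (Nbr e e') = 1 + cost e + cost e'"
| "cost (Plus e e') = 1 + cost e + cost e'"
| "cost (Minus e e') = 1 + cost e + cost e'"
| "cost (Times e e') = 1 + cost e + cost e'"
| "cost (Divide e e') = 1 + cost e + cost e'"

primrec bcost :: "bexp \<Rightarrow> nat" where
  "bcost (Less e e') = 1 + cost e + cost e'"
| "bcost (Equal e e') = 1 + cost e + cost e'"
| "bcost (Not b) = 1 + bcost b"
| "bcost (And b b') = 1 + bcost b + bcost b'"

text \<open>\<open>exec adj c s t s'\<close>: started in s, the program c terminates without a fault in s' after
  t steps.\<close>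

inductive exec :: "(nat \<Rightarrow> nat list option) \<Rightarrow> com \<Rightarrow> state \<Rightarrow> nat \<Rightarrow> state \<Rightarrow> bool"
  for adj where
  Skip: "exec adj Skip s 1 s"
| Assign: "eval adj s e = Some x \<Longrightarrow>
    exec adj (Assign y e) s (1 + cost e) (s\<lparr>vars := (vars s)(y := x)\<rparr>)"
| Store: "\<lbrakk>eval adj s e = Some x; nat_of x = Some i; eval adj s e' = Some y\<rbrakk> \<Longrightarrow>
    exec adj (Store a e e') s (1 + cost e + cost e')
      (s\<lparr>arrs := (arrs s)(a := (arrs s a)(i := y))\<rparr>)"
| Seq: "\<lbrakk>exec adj c s t s'; exec adj c' s' t' s''\<rbrakk> \<Longrightarrow> exec adj (Seq c c') s (t + t') s''"
| IfTrue: "\<lbrakk>beval adj s b = Some True; exec adj c s t s'\<rbrakk> \<Longrightarrow>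
    exec adj (If b c c') s (1 + bcost b + t) s'"
| IfFalse: "\<lbrakk>beval adj s b = Some False; exec adj c' s t s'\<rbrakk> \<Longrightarrow>
    exec adj (If b c c') s (1 + bcost b + t) s'"
| WhileFalse: "beval adj s b = Some False \<Longrightarrow> exec adj (While b c) s (1 + bcost b) s"
| WhileTrue: "\<lbrakk>beval adj s b = Some True; exec adj c s t s'; exec adj (While b c) s' t' s''\<rbrakk> \<Longrightarrow>
    exec adj (While b c) s (1 + bcost b + t + t') s''"

lemma exec_deterministic:
  "exec adj c s t s' \<Longrightarrow> exec adj c s u s'' \<Longrightarrow> u = t \<and> s'' = s'"
proof (induction arbitrary: u s'' rule: exec.induct)
  case (Skip s)
  then show ?case by cases auto
next
  case (Assign s e x y)
  from Assign.prems Assign.hyps show ?case by cases auto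
next
  case (Store s e x i e' y a)
  from Store.prems Store.hyps show ?case by cases auto
next
  case (Seq c s t s' c' t' s2)
  from Seq.prems obtain t1 s1 t2 where "exec adj c s t1 s1" "exec adj c' s1 t2 s''" "u = t1 + t2"
    by cases auto
  with Seq.IH show ?case by blast
next
  case (IfTrue s b c t s' c')
  from IfTrue.prems IfTrue.hyps obtain t1 where "exec adj c s t1 s''" "u = 1 + bcost b + t1"
    by cases auto
  with IfTrue.IH show ?case by blast
next
  case (IfFalse s b c' t s' c)
  from IfFalse.prems IfFalse.hyps obtain t1 where "exec adj c' s t1 s''" "u = 1 + bcost b + t1"
    by cases auto
  with IfFalse.IH show ?case by blast
next
  case (WhileFalse s b c)
  from WhileFalse.prems WhileFalse.hyps show ?case by cases auto
next
  case (WhileTrue s b c t s' t' s2)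
  from WhileTrue.prems WhileTrue.hyps obtain t1 s1 t2 where "exec adj c s t1 s1"
      "exec adj (While b c) s1 t2 s''" "u = 1 + bcost b + t1 + t2"
    by cases auto
  with WhileTrue.IH show ?case by blast
qed

text \<open>
  Input: the number \<open>\<sigma>\<close> in variable \<open>sigma\<close>, the list of vertices in array \<open>A\<close> and its length in
  variable \<open>A\<close>; all other cells are 0. Output: a list of vertices in array \<open>S\<close>, its length in
  variable \<open>S\<close>. The order of the input list is arbitrary and isolated vertices in it do not count
  towards its volume, so no bound in terms of the volume alone can cover the time to read past
  them; a running-time bound has to allow for their number separately.
\<close>

definition initial_state :: "nat list \<Rightarrow> real \<Rightarrow> state" where
  "initial_state as \<sigma> =
     \<lparr>vars = (\<lambda>x. 0)(''sigma'' := \<sigma>, ''A'' := real (length as)),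
      arrs = (\<lambda>a i. 0)(''A'' := (\<lambda>i. if i < length as then real (as ! i) else 0))\<rparr>"

definition output_set :: "state \<Rightarrow> nat set \<Rightarrow> bool" where
  "output_set s S \<longleftrightarrow>
     (\<exists>xs. distinct xs \<and> set xs = S \<and> vars s ''S'' = real (length xs) \<and>
           (\<forall>i<length xs. arrs s ''S'' i = real (xs ! i)))"

lemma output_set_unique:
  assumes "output_set s S" "output_set s S'"
  shows "S = S'"
proof -
  obtain xs ys where xs: "set xs = S" "vars s ''S'' = real (length xs)"
      "\<forall>i<length xs. arrs s ''S'' i = real (xs ! i)"
    and ys: "set ys = S'" "vars s ''S'' = real (length ys)"
      "\<forall>i<length ys. arrs s ''S'' i = real (ys ! i)"
    using assms unfolding output_set_def by blast
  then have "xs = ys" by (intro nth_equalityI) auto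
  with xs ys show ?thesis by simp
qed

text \<open>The logarithmic factor of a running-time bound.\<close>

definition log_factor :: "real \<Rightarrow> real" where
  "log_factor x = max 1 (ln x)"

end

theory Submission
  imports Defs
begin

text \<open>
  Fix k, and let every vertex of A send p units of flow per unit of its degree, let every vertex v
  absorb at most 8 deg(v) units, and give every edge the capacity (p - 8) k. The units are routed
  one at a time by a push-relabel walk with labels of height at most h, where h is about
  k log(vol A / \<sigma>). Only vertices that have absorbed their full share are ever scanned, so that the
  work is local.

  If all units are absorbed, the flow bounds the conductance of every set that overlaps A well
  from below, in terms of 1/k. If a unit is stuck at height h, then among the h level sets of the
  labels there is one whose edges to the next lower level are few compared to its volume: otherwise
  the volumes would grow geometrically from both ends. The outflow of this level set is then almost
  saturated, and conservation of flow bounds its conductance from above, in terms of 1/k. Doubling k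
  until the routing succeeds gives the approximation; the time is dominated by the last value of k,
  which is at most a constant divided by the conductance of the output.
\<close>

section \<open>Cuts and volumes\<close>

text \<open>The constants come from three demands. A full vertex holds 8 units per unit of degree,
  so full vertices have volume at most p vol(A) / 8; this is at most (3/\<sigma>) vol(A) if p \<le>
  24/\<sigma>. The complement of a level set must be estimated without knowing vol(V), and p vol(A)
  / 8 may replace vol(V) if p vol(A) \<le> 8 vol(V); the hypothesis on \<sigma> gives exactly this
  for p \<le> 24/\<sigma> - 16, and vol(A) \<le> vol(V - A) gives it for p = 16. Finally, p must not
  be much smaller than that, or else a successful routing would not yield the factor 4/\<delta>.
  Hence p is the largest integer with (p + 16) \<sigma> \<le> 24, but at least 16. The capacity
  factor p - 8 is the largest net outflow per unit of volume that a set of full vertices can have,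
  so a saturated boundary means conductance at most 1/k, whatever \<sigma> is. Unsaturated edges
  raise this to 5/(4k), and the doubling of k costs another factor 2.\<close>

locale local_graph =
  fixes V :: "nat set" and E :: "nat set set" and adj :: "nat \<Rightarrow> nat list option"
  assumes graph: "simple_graph V E" and adjacency: "adjacency_lists V E adj"
begin

definition nbrs :: "nat \<Rightarrow> nat list" where
  "nbrs v = the (adj v)"

definition wt :: "nat \<Rightarrow> nat \<Rightarrow> real" where
  "wt u v = (if {u, v} \<in> E then 1 else 0)"

lemma finite_V [simp]: "finite V"
  using graph by (simp add: simple_graph_def)

lemma finite_subset_V: "S \<subseteq> V \<Longrightarrow> finite S"
  using finite_subset finite_V by blast

lemma edge_vertices: "{u, v} \<in> E \<Longrightarrow> u \<in> V \<and> v \<in> V \<and> u \<noteq> v"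
  using graph unfolding simple_graph_def by (metis doubleton_eq_iff)

lemma adj_eq: "v \<in> V \<Longrightarrow> adj v = Some (nbrs v)"
  using adjacency unfolding adjacency_lists_def nbrs_def by auto

lemma set_nbrs: "v \<in> V \<Longrightarrow> set (nbrs v) = {u. {u, v} \<in> E}"
  using adjacency adj_eq unfolding adjacency_lists_def by blast

lemma distinct_nbrs: "v \<in> V \<Longrightarrow> distinct (nbrs v)"
  using adjacency adj_eq unfolding adjacency_lists_def by blast

lemma degree_eq_card: "degree E v = card {u. {u, v} \<in> E}"
proof -
  have "{e \<in> E. v \<in> e} = (\<lambda>u. {u, v}) ` {u. {u, v} \<in> E}"
  proof (intro equalityI subsetI)
    fix e assume e: "e \<in> {e \<in> E. v \<in> e}"
    then obtain a b where "e = {a, b}" using graph unfolding simple_graph_def by blast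
    with e show "e \<in> (\<lambda>u. {u, v}) ` {u. {u, v} \<in> E}" by (auto simp: insert_commute)
  qed auto
  moreover have "inj_on (\<lambda>u. {u, v}) {u. {u, v} \<in> E}"
    by (auto simp: inj_on_def doubleton_eq_iff)
  ultimately show ?thesis by (simp add: degree_def card_image)
qed

lemma length_nbrs: "v \<in> V \<Longrightarrow> length (nbrs v) = degree E v"
  using set_nbrs distinct_nbrs distinct_card degree_eq_card by metis

lemma nth_nbrs:
  assumes "v \<in> V" "i < degree E v"
  shows "{v, nbrs v ! i} \<in> E" "nbrs v ! i \<in> V"
proof -
  have "nbrs v ! i \<in> set (nbrs v)" using assms length_nbrs by simp
  then show "{v, nbrs v ! i} \<in> E" using set_nbrs assms by (auto simp: insert_commute)
  then show "nbrs v ! i \<in> V" using edge_vertices by blast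
qed

lemma wt_commute: "wt u v = wt v u"
  by (simp add: wt_def insert_commute)

lemma wt_nonneg [simp]: "0 \<le> wt u v"
  by (simp add: wt_def)

lemma sum_wt_card: "finite T \<Longrightarrow> (\<Sum>u\<in>T. wt v u) = card {u \<in> T. {v, u} \<in> E}"
  by (simp add: wt_def sum.If_cases Int_def)

lemma degree_eq_wt: "real (degree E v) = (\<Sum>u\<in>V. wt v u)"
proof -
  have "{u. {u, v} \<in> E} = {u \<in> V. {v, u} \<in> E}"
    using edge_vertices by (auto simp: insert_commute)
  then show ?thesis by (simp add: degree_eq_card sum_wt_card)
qed

lemma degree_pos: "{u, v} \<in> E \<Longrightarrow> 0 < degree E u"
proof -
  assume a: "{u, v} \<in> E"
  have "finite {w. {w, u} \<in> E}"
    by (rule finite_subset[OF _ finite_V]) (use edge_vertices in auto)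
  moreover have "v \<in> {w. {w, u} \<in> E}" using a by (simp add: insert_commute)
  ultimately show ?thesis unfolding degree_eq_card by (metis card_gt_0_iff empty_iff)
qed

lemma vol_disjoint_Un: "finite S \<Longrightarrow> finite T \<Longrightarrow> S \<inter> T = {} \<Longrightarrow> vol E (S \<union> T) = vol E S + vol E T"
  by (simp add: vol_def sum.union_disjoint)

lemma vol_Int_Diff: "finite S \<Longrightarrow> vol E S = vol E (S \<inter> T) + vol E (S - T)"
  unfolding vol_def by (rule sum.Int_Diff)

lemma vol_mono: "finite T \<Longrightarrow> S \<subseteq> T \<Longrightarrow> vol E S \<le> vol E T"
  unfolding vol_def by (rule sum_mono2) auto

text \<open>Counts the ordered pairs, so it is the size of the cut when S and T are disjoint.\<close>

definition cut :: "nat set \<Rightarrow> nat set \<Rightarrow> real" where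
  "cut S T = (\<Sum>v\<in>S. \<Sum>u\<in>T. wt v u)"

lemma cut_nonneg: "0 \<le> cut S T"
  unfolding cut_def by (intro sum_nonneg) auto

lemma cut_le_vol:
  assumes "S \<subseteq> V" "T \<subseteq> V" shows "cut S T \<le> vol E S"
  unfolding cut_def vol_def of_nat_sum degree_eq_wt
  by (intro sum_mono sum_mono2) (use assms in auto)

lemma cut_commute: "cut S T = cut T S"
  unfolding cut_def by (subst sum.swap) (simp add: wt_commute)

lemma card_edges_between:
  assumes "S \<subseteq> V"
  shows "real (card (edges_between E S (V - S))) = cut S (V - S)"
proof -
  let ?P = "SIGMA v:S. {u \<in> V - S. {v, u} \<in> E}"
  have "edges_between E S (V - S) = (\<lambda>(v, u). {v, u}) ` ?P"
    unfolding edges_between_def by auto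
  moreover have "inj_on (\<lambda>(v, u). {v, u}) ?P"
    by (auto simp: inj_on_def doubleton_eq_iff)
  ultimately have "card (edges_between E S (V - S)) = card ?P"
    by (simp add: card_image)
  also have "\<dots> = (\<Sum>v\<in>S. card {u \<in> V - S. {v, u} \<in> E})"
    using assms finite_subset_V by (subst card_SigmaI) auto
  finally show ?thesis unfolding cut_def by (simp add: sum_wt_card)
qed

lemma conductance_cut:
  "S \<subseteq> V \<Longrightarrow> conductance V E S = cut S (V - S) / min (real (vol E S)) (real (vol E (V - S)))"
  by (simp add: conductance_def card_edges_between of_nat_min)

end


section \<open>Routing by push and relabel\<close>

text \<open>\<open>psh\<close> counts the pushes over each ordered pair and never decreases; pushes
  in opposite directions are cancelled only in the difference \<open>flow\<close>.
  \<open>src\<close> is the index of the source being served, and \<open>cur\<close> is the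
  current-arc pointer of push-relabel. If \<open>tok\<close> is false, no unit is under way and
  \<open>pos\<close> is a leftover of the last one (initially 0).\<close>

record routing_state =
  src :: nat
  pos :: nat
  tok :: bool
  lev :: "nat \<Rightarrow> nat"
  cur :: "nat \<Rightarrow> nat"
  absd :: "nat \<Rightarrow> nat"
  inj :: "nat \<Rightarrow> nat"
  psh :: "nat \<Rightarrow> nat \<Rightarrow> nat"
  lst :: "nat list"

definition empty_routing :: routing_state where
  "empty_routing = \<lparr>src = 0, pos = 0, tok = False, lev = (\<lambda>v. 0), cur = (\<lambda>v. 0), absd = (\<lambda>v. 0),
     inj = (\<lambda>v. 0), psh = (\<lambda>u v. 0), lst = []\<rparr>"

locale routing = local_graph +
  fixes bs :: "nat list" and p K h :: nat
  assumes bs: "distinct bs" "set bs \<subseteq> V" "\<And>v. v \<in> set bs \<Longrightarrow> 0 < degree E v"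
    and h_pos: "0 < h"
begin

text \<open>The order of the tests makes the walk local: a vertex is scanned only after it has
  absorbed its share. The pointer stays in place after a push, since the same arc may serve
  again.\<close>

definition step :: "routing_state \<Rightarrow> routing_state" where
  "step a = (let x = pos a in
     if \<not> tok a then
       (let v = bs ! src a in
        if inj a v < p * degree E v
        then a\<lparr>inj := (inj a)(v := inj a v + 1), pos := v, tok := True\<rparr>
        else a\<lparr>src := src a + 1\<rparr>)
     else if absd a x < 8 * degree E x then a\<lparr>absd := (absd a)(x := absd a x + 1), tok := False\<rparr>
     else if cur a x < degree E x then
       (let u = nbrs x ! cur a x in
        if psh a x u < K + psh a u x \<and> lev a x = lev a u + 1
        then a\<lparr>psh := (psh a)(x := (psh a x)(u := psh a x u + 1)), pos := u\<rparr>
        else a\<lparr>cur := (cur a)(x := cur a x + 1)\<rparr>)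
     else a\<lparr>lev := (lev a)(x := lev a x + 1), cur := (cur a)(x := 0),
            lst := (if lev a x = 0 then lst a @ [x] else lst a)\<rparr>)"

text \<open>The label of \<open>pos\<close> is tested even if no unit is under way;
  \<open>inv\<close> keeps that label 0 then, so this test fails only for a stuck unit.\<close>

definition running :: "routing_state \<Rightarrow> bool" where
  "running a \<longleftrightarrow> lev a (pos a) < h \<and> (tok a \<or> src a < length bs)"

definition residual :: "routing_state \<Rightarrow> nat \<Rightarrow> nat \<Rightarrow> bool" where
  "residual a u v \<longleftrightarrow> {u, v} \<in> E \<and> psh a u v < K + psh a v u"

text \<open>Labels and pointers become positive only at full vertices; this clause is what bounds
  the work. On residual arcs the label drops by at most one, the valid labelling of push-relabel.
  The clause on \<open>cur\<close> says that no arc already passed by the pointer is both residual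
  and downhill, which licenses relabelling at the end of the list.\<close>

definition inv :: "routing_state \<Rightarrow> bool" where
  "inv a \<longleftrightarrow>
     (\<forall>v\<in>V. inj a v + (\<Sum>u\<in>V. psh a u v)
            = absd a v + (\<Sum>u\<in>V. psh a v u) + (if tok a \<and> pos a = v then 1 else 0)) \<and>
     (\<forall>v. absd a v \<le> 8 * degree E v) \<and>
     (\<forall>v. 0 < lev a v \<or> 0 < cur a v \<longrightarrow> absd a v = 8 * degree E v \<and> v \<in> V \<and> 0 < degree E v) \<and>
     (\<forall>u v. psh a u v \<le> K + psh a v u) \<and>
     (\<forall>u v. 0 < psh a u v \<longrightarrow> {u, v} \<in> E) \<and>
     (\<forall>u v. residual a u v \<longrightarrow> lev a u \<le> lev a v + 1) \<and>
     (\<forall>u\<in>V. \<forall>i<cur a u. residual a u (nbrs u ! i) \<longrightarrow> lev a u \<le> lev a (nbrs u ! i)) \<and>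
     (\<forall>v. cur a v \<le> degree E v) \<and> (\<forall>v. lev a v \<le> h) \<and>
     (if tok a then pos a \<in> V \<and> 0 < degree E (pos a) else lev a (pos a) = 0) \<and>
     distinct (lst a) \<and> set (lst a) = {v. 0 < lev a v} \<and>
     (\<forall>v. inj a v \<le> p * degree E v) \<and> (\<forall>v. 0 < inj a v \<longrightarrow> v \<in> set bs) \<and>
     (\<forall>i<src a. inj a (bs ! i) = p * degree E (bs ! i)) \<and> src a \<le> length bs"

lemma inv_conserve: "inv a \<Longrightarrow> v \<in> V \<Longrightarrow> inj a v + (\<Sum>u\<in>V. psh a u v)
    = absd a v + (\<Sum>u\<in>V. psh a v u) + (if tok a \<and> pos a = v then 1 else 0)"
  and inv_absd_le: "inv a \<Longrightarrow> absd a v \<le> 8 * degree E v"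
  and inv_full: "inv a \<Longrightarrow> 0 < lev a v \<or> 0 < cur a v \<Longrightarrow>
    absd a v = 8 * degree E v \<and> v \<in> V \<and> 0 < degree E v"
  and inv_capacity: "inv a \<Longrightarrow> psh a u v \<le> K + psh a v u"
  and inv_support: "inv a \<Longrightarrow> 0 < psh a u v \<Longrightarrow> {u, v} \<in> E"
  and inv_lev_residual: "inv a \<Longrightarrow> residual a u v \<Longrightarrow> lev a u \<le> lev a v + 1"
  and inv_cur: "inv a \<Longrightarrow> u \<in> V \<Longrightarrow> i < cur a u \<Longrightarrow> residual a u (nbrs u ! i) \<Longrightarrow>
    lev a u \<le> lev a (nbrs u ! i)"
  and inv_cur_le: "inv a \<Longrightarrow> cur a v \<le> degree E v"
  and inv_lev_le: "inv a \<Longrightarrow> lev a v \<le> h"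
  and inv_tok: "inv a \<Longrightarrow> tok a \<Longrightarrow> pos a \<in> V \<and> 0 < degree E (pos a)"
  and inv_no_tok: "inv a \<Longrightarrow> \<not> tok a \<Longrightarrow> lev a (pos a) = 0"
  and inv_distinct: "inv a \<Longrightarrow> distinct (lst a)"
  and inv_lst: "inv a \<Longrightarrow> set (lst a) = {v. 0 < lev a v}"
  and inv_inj_le: "inv a \<Longrightarrow> inj a v \<le> p * degree E v"
  and inv_inj: "inv a \<Longrightarrow> 0 < inj a v \<Longrightarrow> v \<in> set bs"
  and inv_src: "inv a \<Longrightarrow> i < src a \<Longrightarrow> inj a (bs ! i) = p * degree E (bs ! i)"
  and inv_src_le: "inv a \<Longrightarrow> src a \<le> length bs"
  unfolding inv_def by ((elim conjE, blast) | (elim conjE, simp))+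

lemma inv_empty: "inv empty_routing"
  by (simp add: inv_def empty_routing_def residual_def)

lemma sum_upd:
  fixes f :: "nat \<Rightarrow> nat"
  assumes "finite A"
  shows "(\<Sum>w\<in>A. (f(x := f x + 1)) w) = (\<Sum>w\<in>A. f w) + (if x \<in> A then 1 else 0)"
proof -
  have "(f(x := f x + 1)) w = f w + (if w = x then 1 else 0)" for w by simp
  then have "(\<Sum>w\<in>A. (f(x := f x + 1)) w) = (\<Sum>w\<in>A. f w + (if w = x then 1 else 0))"
    by presburger
  then show ?thesis using assms by (simp add: sum.distrib)
qed

lemma inv_step:
  assumes I: "inv a" and R: "running a"
  shows "inv (step a)"
proof (cases "tok a")
  case False
  then have src: "src a < length bs" using R by (simp add: running_def)
  let ?v = "bs ! src a"
  have v: "?v \<in> V" "0 < degree E ?v" "?v \<in> set bs" using bs src by auto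
  show ?thesis
  proof (cases "inj a ?v < p * degree E ?v")
    case True
    have "i < src a \<Longrightarrow> bs ! i \<noteq> ?v" for i
      using src bs(1) by (simp add: nth_eq_iff_index_eq)
    then show ?thesis
      using I False True v unfolding inv_def step_def residual_def
      by (auto simp: Let_def)
  next
    case inj: False
    then have "inj a ?v = p * degree E ?v" using I unfolding inv_def by (meson le_antisym not_le)
    then show ?thesis
      using I False inj src unfolding inv_def step_def residual_def
      by (auto simp: Let_def less_Suc_eq)
  qed
next
  case True
  let ?x = "pos a"
  have x: "?x \<in> V" "0 < degree E ?x" "lev a ?x < h" using True I R by (auto simp: inv_def running_def)
  show ?thesis
  proof (cases "absd a ?x < 8 * degree E ?x")
    case ab: True
    \<comment> \<open>A vertex that still absorbs has label 0, as \<open>inv\<close> demands of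
      \<open>pos\<close> once the unit is gone.\<close>
    then have "\<not> (0 < lev a ?x \<or> 0 < cur a ?x)" using inv_full[OF I, of ?x] by linarith
    then show ?thesis
      using I True ab unfolding inv_def step_def residual_def
      by (auto simp: Let_def)
  next
    case ab: False
    then have abx: "absd a ?x = 8 * degree E ?x" using inv_absd_le[OF I, of ?x] by linarith
    show ?thesis
    proof (cases "cur a ?x < degree E ?x")
      case c: True
      let ?u = "nbrs ?x ! cur a ?x"
      have u: "{?x, ?u} \<in> E" "?u \<in> V" "?u \<noteq> ?x" "0 < degree E ?u"
        using nth_nbrs[OF x(1) c] edge_vertices degree_pos by (auto simp: insert_commute)
      show ?thesis
      proof (cases "psh a ?x ?u < K + psh a ?u ?x \<and> lev a ?x = lev a ?u + 1")
        case push: True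
        let ?g = "(psh a)(?x := (psh a ?x)(?u := psh a ?x ?u + 1))"
        have s: "step a = a\<lparr>psh := ?g, pos := ?u\<rparr>"
          using True ab c push by (simp add: step_def Let_def)
        have out: "(\<Sum>w\<in>V. ?g v w) = (\<Sum>w\<in>V. psh a v w) + (if v = ?x then 1 else 0)" for v
          using sum_upd[OF finite_V, of "psh a ?x" ?u] u by simp
        have "?g w v = (if v = ?u then ((\<lambda>w. psh a w ?u)(?x := psh a ?x ?u + 1)) w else psh a w v)" for w v
          by simp
        then have "(\<Sum>w\<in>V. ?g w v) = (\<Sum>w\<in>V. if v = ?u then ((\<lambda>w. psh a w ?u)(?x := psh a ?x ?u + 1)) w else psh a w v)" for v
          by presburger
        then have inn: "(\<Sum>w\<in>V. ?g w v) = (\<Sum>w\<in>V. psh a w v) + (if v = ?u then 1 else 0)" for v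
          using sum_upd[OF finite_V, of "\<lambda>w. psh a w ?u" ?x] x by simp
        \<comment> \<open>Only the reverse arc can become residual, and it leads one level up, so it
          violates neither the labelling nor the pointer clause.\<close>
        have res: "residual (a\<lparr>psh := ?g, pos := ?u\<rparr>) w v \<Longrightarrow> residual a w v \<or> (w = ?u \<and> v = ?x)" for w v
          unfolding residual_def using u by (auto split: if_splits)
        have cons: "\<forall>v\<in>V. inj a v + (\<Sum>u\<in>V. ?g u v)
            = absd a v + (\<Sum>u\<in>V. ?g v u) + (if ?u = v then 1 else 0)"
          unfolding out inn using I True u(3) unfolding inv_def by auto
        have cap: "\<forall>w v. ?g w v \<le> K + ?g v w"
        proof (intro allI)
          fix w v
          have "psh a w v \<le> K + psh a v w" using I unfolding inv_def by blast
          then show "?g w v \<le> K + ?g v w" using push u(3) by auto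
        qed
        have lab: "\<forall>w v. residual (a\<lparr>psh := ?g, pos := ?u\<rparr>) w v \<longrightarrow> lev a w \<le> lev a v + 1"
          using inv_lev_residual[OF I] res push by fastforce
        have arc: "\<forall>w\<in>V. \<forall>i<cur a w. residual (a\<lparr>psh := ?g, pos := ?u\<rparr>) w (nbrs w ! i) \<longrightarrow> lev a w \<le> lev a (nbrs w ! i)"
          using inv_cur[OF I] res push by fastforce
        have sup: "\<forall>w v. 0 < ?g w v \<longrightarrow> {w, v} \<in> E"
          using inv_support[OF I] u by auto
        show ?thesis
          unfolding s using I cons cap lab arc sup u True unfolding inv_def by simp
      next
        case np: False
        \<comment> \<open>A residual arc that is not taken fails the label test; as the label drops
          by at most one, the arc does not lead down and may be passed.\<close>
        have "residual a ?x ?u \<Longrightarrow> lev a ?x \<le> lev a ?u"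
          using np inv_lev_residual[OF I, of ?x ?u] unfolding residual_def by linarith
        then have "\<forall>i<Suc (cur a ?x). residual a ?x (nbrs ?x ! i) \<longrightarrow> lev a ?x \<le> lev a (nbrs ?x ! i)"
          using inv_cur[OF I x(1)] by (metis less_SucE)
        moreover have "step a = a\<lparr>cur := (cur a)(?x := cur a ?x + 1)\<rparr>"
          using True ab c np by (auto simp: step_def Let_def)
        ultimately show ?thesis
          using I c abx x unfolding inv_def residual_def by simp
      qed
    next
      case c: False
      let ?l = "(lev a)(?x := lev a ?x + 1)"
      have s: "step a = a\<lparr>lev := ?l, cur := (cur a)(?x := 0),
            lst := (if lev a ?x = 0 then lst a @ [?x] else lst a)\<rparr>"
        using True ab c by (simp add: step_def Let_def)
      have "cur a ?x = degree E ?x" using inv_cur_le[OF I, of ?x] c by linarith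
      \<comment> \<open>The pointer has reached the end of the list, so no residual arc leads down
        and the label may grow by one.\<close>
      then have adm: "residual a ?x v \<Longrightarrow> lev a ?x \<le> lev a v" for v
      proof -
        assume r: "residual a ?x v"
        then have "v \<in> set (nbrs ?x)" using set_nbrs x by (auto simp: residual_def insert_commute)
        then obtain i where "i < degree E ?x" "nbrs ?x ! i = v"
          using length_nbrs x by (metis in_set_conv_nth)
        then show ?thesis using inv_cur[OF I x(1)] r \<open>cur a ?x = degree E ?x\<close> by metis
      qed
      have lab: "\<forall>w v. residual a w v \<longrightarrow> ?l w \<le> ?l v + 1"
        using inv_lev_residual[OF I] adm by (auto simp: le_SucI)
      have arc: "\<forall>w\<in>V. \<forall>i<((cur a)(?x := 0)) w. residual a w (nbrs w ! i) \<longrightarrow> ?l w \<le> ?l (nbrs w ! i)"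
        using inv_cur[OF I] by (fastforce intro: le_SucI)
      have ls: "distinct (if lev a ?x = 0 then lst a @ [?x] else lst a)"
         "set (if lev a ?x = 0 then lst a @ [?x] else lst a) = {v. 0 < ?l v}"
        using inv_distinct[OF I] inv_lst[OF I] by auto
      have r: "residual (step a) = residual a" unfolding s residual_def by simp
      show ?thesis
        unfolding inv_def r using I lab arc ls abx x True unfolding s inv_def by simp
    qed
  qed
qed

text \<open>Every step increases this quantity: a push pays with the lower label of the new position of
  the unit, and this is regained when a vertex is relabelled or a new unit is injected.\<close>

definition work :: "routing_state \<Rightarrow> int" where
  "work a = int (src a) + (int h + 1) * int (\<Sum>v\<in>V. inj a v) + int (\<Sum>v\<in>V. absd a v)
     + int (\<Sum>v\<in>V. lev a v * (degree E v + 2) + cur a v) + (int h - int (lev a (pos a)))"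

lemma work_step:
  assumes I: "inv a" and R: "running a"
  shows "work a < work (step a)"
proof (cases "tok a")
  case False
  then have src: "src a < length bs" using R by (simp add: running_def)
  let ?v = "bs ! src a"
  have v: "?v \<in> V" "lev a ?v \<le> h" "lev a (pos a) = 0"
    using bs src I False by (auto simp: inv_def)
  \<comment> \<open>An injection gains h + 1 and loses at most h, because \<open>pos\<close> moves
    from label 0 to a label of at most h.\<close>
  show ?thesis
    using False v sum_upd[OF finite_V, of "inj a" ?v]
    unfolding step_def work_def by (auto simp: Let_def algebra_simps simp del: fun_upd_apply of_nat_sum)
next
  case True
  let ?x = "pos a"
  have x: "?x \<in> V" using True I by (auto simp: inv_def)
  let ?F = "\<lambda>l c w. l w * (degree E w + 2) + c w :: nat"
  have upd: "(\<Sum>w\<in>V. ?F l' c' w) + ?F l c ?x = (\<Sum>w\<in>V. ?F l c w) + ?F l' c' ?x"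
    if "\<And>w. w \<noteq> ?x \<Longrightarrow> l w = l' w \<and> c w = c' w" for l l' c c' :: "nat \<Rightarrow> nat"
  proof -
    have "(\<Sum>w\<in>V - {?x}. ?F l' c' w) = (\<Sum>w\<in>V - {?x}. ?F l c w)"
      by (intro sum.cong) (use that in auto)
    then show ?thesis
      using sum.remove[OF finite_V x, of "?F l c"] sum.remove[OF finite_V x, of "?F l' c'"] by linarith
  qed
  show ?thesis
  proof (cases "absd a ?x < 8 * degree E ?x")
    case ab: True
    then show ?thesis using True x sum_upd[OF finite_V, of "absd a" ?x]
      unfolding step_def work_def by (auto simp: Let_def)
  next
    case ab: False
    show ?thesis
    proof (cases "cur a ?x < degree E ?x")
      case c: True
      then show ?thesis
        using True ab upd[of "lev a" "lev a" "cur a" "(cur a)(?x := cur a ?x + 1)"]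
        unfolding step_def work_def by (auto simp: Let_def simp del: of_nat_sum)
    next
      case c: False
      \<comment> \<open>The weight deg + 2 of a label pays for the pointer falling from deg to 0 and
        for the smaller difference between h and the label, and still leaves a gain of 1.\<close>
      then have "cur a ?x = degree E ?x" using I unfolding inv_def by (meson le_antisym not_le)
      then show ?thesis
        using True ab c upd[of "lev a" "(lev a)(?x := lev a ?x + 1)" "cur a" "(cur a)(?x := 0)"]
        unfolding step_def work_def by (simp add: Let_def del: of_nat_sum)
    qed
  qed
qed

end


section \<open>The flow and its level sets\<close>

context routing begin

definition level_set :: "routing_state \<Rightarrow> nat \<Rightarrow> nat set" where
  "level_set a j = {v. j \<le> lev a v}"

lemma level_set_subset: "inv a \<Longrightarrow> 0 < j \<Longrightarrow> level_set a j \<subseteq> V"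
  using inv_full by (fastforce simp: level_set_def)

lemma level_set_full: "inv a \<Longrightarrow> 0 < j \<Longrightarrow> v \<in> level_set a j \<Longrightarrow> absd a v = 8 * degree E v"
  using inv_full by (fastforce simp: level_set_def)

lemma sum_inj_le:
  assumes "inv a" "S \<subseteq> V"
  shows "(\<Sum>v\<in>S. inj a v) \<le> p * vol E (set bs \<inter> S)"
proof -
  have S: "finite S" using assms finite_subset_V by blast
  have "(\<Sum>v\<in>S. inj a v) = (\<Sum>v\<in>S \<inter> set bs. inj a v)"
    using inv_inj[OF assms(1)] by (intro sum.mono_neutral_right) (use S in auto)
  also have "\<dots> \<le> (\<Sum>v\<in>S \<inter> set bs. p * degree E v)"
    using inv_inj_le[OF assms(1)] by (intro sum_mono) auto
  finally show ?thesis by (simp add: vol_def sum_distrib_left Int_commute)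
qed

definition flow :: "routing_state \<Rightarrow> nat \<Rightarrow> nat \<Rightarrow> real" where
  "flow a v u = real (psh a v u) - real (psh a u v)"

lemma flow_le: "inv a \<Longrightarrow> flow a v u \<le> K * wt v u"
  using inv_capacity[of a v u] inv_support[of a v u]
  by (cases "psh a v u = 0") (auto simp: flow_def wt_def)

lemma flow_ge: "inv a \<Longrightarrow> - (K * wt v u) \<le> flow a v u"
  using flow_le[of a u v] by (simp add: flow_def wt_commute)

lemma net_outflow:
  assumes I: "inv a" and S: "S \<subseteq> V"
  shows "real (\<Sum>v\<in>S. inj a v) = real (\<Sum>v\<in>S. absd a v) + (\<Sum>v\<in>S. \<Sum>u\<in>V - S. flow a v u)
     + (if tok a \<and> pos a \<in> S then 1 else 0)"
proof -
  have fS: "finite S" using S finite_subset_V by blast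
  have "real (inj a v) = real (absd a v) + (\<Sum>u\<in>V. flow a v u) + (if tok a \<and> pos a = v then 1 else 0)"
    if "v \<in> S" for v
  proof -
    have "real (inj a v + (\<Sum>u\<in>V. psh a u v))
       = real (absd a v + (\<Sum>u\<in>V. psh a v u) + (if tok a \<and> pos a = v then 1 else 0))"
      using inv_conserve[OF I] that S by (metis subset_iff)
    then show ?thesis by (simp add: flow_def sum_subtractf split: if_splits)
  qed
  then have "real (\<Sum>v\<in>S. inj a v) = (\<Sum>v\<in>S. real (absd a v) + (\<Sum>u\<in>V. flow a v u) + (if tok a \<and> pos a = v then 1 else 0))"
    by simp
  also have "\<dots> = real (\<Sum>v\<in>S. absd a v) + (\<Sum>v\<in>S. \<Sum>u\<in>V. flow a v u)
     + (\<Sum>v\<in>S. if tok a \<and> pos a = v then 1 else 0)"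
    by (simp add: sum.distrib)
  also have "(\<Sum>v\<in>S. if tok a \<and> pos a = v then 1 else 0) = (if tok a \<and> pos a \<in> S then 1 else 0 :: real)"
    using fS by (cases "tok a") auto
  also have "(\<Sum>v\<in>S. \<Sum>u\<in>V. flow a v u) = (\<Sum>v\<in>S. \<Sum>u\<in>V - S. flow a v u)"
  proof -
    have "(\<Sum>u\<in>V. flow a v u) = (\<Sum>u\<in>V - S. flow a v u) + (\<Sum>u\<in>S. flow a v u)" for v
      using sum.subset_diff[OF S finite_V] .
    then have "(\<Sum>v\<in>S. \<Sum>u\<in>V. flow a v u) = (\<Sum>v\<in>S. \<Sum>u\<in>V - S. flow a v u) + (\<Sum>v\<in>S. \<Sum>u\<in>S. flow a v u)"
      by (simp add: sum.distrib)
    moreover have "(\<Sum>v\<in>S. \<Sum>u\<in>S. flow a v u) = 0"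
      unfolding flow_def sum_subtractf by (subst sum.swap) simp
    ultimately show ?thesis by simp
  qed
  finally show ?thesis .
qed

text \<open>Supply that starts in S is absorbed in S or leaves through the boundary, whose capacity
  is \<open>K * cut S (V - S)\<close>. As S is arbitrary, one successful routing certifies all sets
  at once, among them the unknown target.\<close>

lemma routed_cut_bound:
  assumes I: "inv a" and routed: "\<not> tok a" "src a = length bs" and S: "S \<subseteq> V"
  shows "real p * vol E (set bs \<inter> S) \<le> 8 * real (vol E S) + real K * cut S (V - S)"
proof -
  have "inj a v = p * degree E v" if "v \<in> set bs" for v
    using inv_src[OF I] that routed by (metis in_set_conv_nth)
  then have "p * vol E (set bs \<inter> S) = (\<Sum>v\<in>set bs \<inter> S. inj a v)"
    by (simp add: vol_def sum_distrib_left)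
  also have "\<dots> \<le> (\<Sum>v\<in>S. inj a v)"
    using S finite_subset_V by (intro sum_mono2) auto
  finally have "real (p * vol E (set bs \<inter> S)) \<le> real (\<Sum>v\<in>S. inj a v)" by (rule of_nat_mono)
  also have "\<dots> = real (\<Sum>v\<in>S. absd a v) + (\<Sum>v\<in>S. \<Sum>u\<in>V - S. flow a v u)"
    using net_outflow[OF I S] routed by simp
  also have "real (\<Sum>v\<in>S. absd a v) \<le> real (\<Sum>v\<in>S. 8 * degree E v)"
    using inv_absd_le[OF I] by (intro of_nat_mono sum_mono)
  also have "(\<Sum>v\<in>S. \<Sum>u\<in>V - S. flow a v u) \<le> (\<Sum>v\<in>S. \<Sum>u\<in>V - S. K * wt v u)"
    using flow_le[OF I] by (intro sum_mono)
  finally show ?thesis by (simp add: vol_def cut_def sum_distrib_left)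
qed

lemma sum_absd_le:
  assumes I: "inv a"
  shows "(\<Sum>v\<in>V. absd a v) + (if tok a then 1 else 0) = (\<Sum>v\<in>V. inj a v)"
    and "(\<Sum>v\<in>V. inj a v) \<le> p * vol E (set bs)"
proof -
  have "real (\<Sum>v\<in>V. inj a v) = real (\<Sum>v\<in>V. absd a v) + (if tok a then 1 else 0)"
    using net_outflow[OF I subset_refl] inv_tok[OF I] by auto
  then have "real (\<Sum>v\<in>V. inj a v) = real ((\<Sum>v\<in>V. absd a v) + (if tok a then 1 else 0))"
    by simp
  then show "(\<Sum>v\<in>V. absd a v) + (if tok a then 1 else 0) = (\<Sum>v\<in>V. inj a v)"
    by (metis of_nat_eq_iff)
  show "(\<Sum>v\<in>V. inj a v) \<le> p * vol E (set bs)"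
    using sum_inj_le[OF I subset_refl] bs(2) by (simp add: Int_absorb2)
qed

text \<open>Full vertices hold 8 units per unit of degree, and all these units were injected. The
  unit under way makes the bound strict; this slack is the starting value of the growth from the
  lowest level, and it keeps the volume of the complement of an output positive.\<close>

lemma full_vol_le:
  assumes I: "inv a" and S: "S \<subseteq> V" "\<And>v. v \<in> S \<Longrightarrow> absd a v = 8 * degree E v"
  shows "8 * vol E S + (if tok a then 1 else 0) \<le> p * vol E (set bs)"
proof -
  have "8 * vol E S = (\<Sum>v\<in>S. absd a v)" using S(2) by (simp add: vol_def sum_distrib_left)
  also have "\<dots> \<le> (\<Sum>v\<in>V. absd a v)" using S(1) by (intro sum_mono2) auto
  finally show ?thesis using sum_absd_le[OF I] by linarith
qed

lemma level_set_vol_le: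
  "inv a \<Longrightarrow> 0 < j \<Longrightarrow> 8 * vol E (level_set a j) + (if tok a then 1 else 0) \<le> p * vol E (set bs)"
  by (rule full_vol_le) (simp_all add: level_set_subset level_set_full)

text \<open>The bound is independent of the size of V: vertices with a positive label or pointer are
  full and nonisolated, so their volume is at most p vol(A) / 8, and each contributes at most 4h per
  unit of degree.\<close>

lemma work_le:
  assumes I: "inv a"
  shows "work a \<le> 6 * int h * int (p * vol E (set bs)) + int (length bs) + int h"
proof -
  let ?T = "p * vol E (set bs)"
  let ?S = "{v \<in> V. absd a v = 8 * degree E v \<and> 0 < degree E v}"
  have "8 * vol E ?S + (if tok a then 1 else 0) \<le> ?T" by (rule full_vol_le[OF I]) auto
  then have T: "8 * vol E ?S \<le> ?T" by linarith
  have "(\<Sum>v\<in>V. lev a v * (degree E v + 2) + cur a v)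
     = (\<Sum>v\<in>?S. lev a v * (degree E v + 2) + cur a v)"
  proof (intro sum.mono_neutral_right ballI)
    fix v assume v: "v \<in> V - ?S"
    have "\<not> (0 < lev a v \<or> 0 < cur a v)"
    proof
      assume "0 < lev a v \<or> 0 < cur a v"
      from inv_full[OF I this] show False using v by simp
    qed
    then show "lev a v * (degree E v + 2) + cur a v = 0" by simp
  qed auto
  also have "\<dots> \<le> (\<Sum>v\<in>?S. 4 * h * degree E v)"
  proof (intro sum_mono)
    fix v assume v: "v \<in> ?S"
    \<comment> \<open>Vertices of \<open>?S\<close> have positive degree, so deg + 2 \<le> 3
      deg.\<close>
    have "lev a v * (degree E v + 2) \<le> h * (3 * degree E v)"
      using inv_lev_le[OF I] v by (intro mult_le_mono) auto
    moreover have "cur a v \<le> 1 * degree E v" using inv_cur_le[OF I] by simp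
    moreover have "1 * degree E v \<le> h * degree E v" using h_pos by (intro mult_le_mono1) simp
    ultimately show "lev a v * (degree E v + 2) + cur a v \<le> 4 * h * degree E v" by linarith
  qed
  also have "\<dots> = 4 * h * vol E ?S" by (simp add: vol_def sum_distrib_left)
  also have "\<dots> \<le> h * ?T" using T mult_le_mono2[of "4 * vol E ?S" ?T h] by simp
  finally have L: "int (\<Sum>v\<in>V. lev a v * (degree E v + 2) + cur a v) \<le> int h * int ?T" by (metis of_nat_mono of_nat_mult)
  have Ij: "int (\<Sum>v\<in>V. inj a v) \<le> int ?T" using sum_absd_le(2)[OF I] by (rule of_nat_mono)
  then have "(int h + 1) * int (\<Sum>v\<in>V. inj a v) \<le> (int h + 1) * int ?T" by (intro mult_left_mono) auto
  moreover have "int (\<Sum>v\<in>V. absd a v) \<le> int ?T"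
    using sum_absd_le[OF I] by (intro of_nat_mono) linarith
  moreover have "int (src a) \<le> int (length bs)" using inv_src_le[OF I] by simp
  moreover have "1 * int ?T \<le> int h * int ?T" using h_pos by (intro mult_right_mono) auto
  moreover have "(int h + 1) * int ?T = int h * int ?T + int ?T" by (simp add: algebra_simps)
  ultimately show ?thesis using L unfolding work_def by linarith
qed

section \<open>Edges between consecutive levels\<close>

definition level :: "routing_state \<Rightarrow> nat \<Rightarrow> nat set" where
  "level a j = {v \<in> V. lev a v = j}"

text \<open>The edges between consecutive levels are the only ones leaving a level set on which the
  outflow may be smaller than the capacity.\<close>

lemma level_set_outflow:
  assumes I: "inv a" and j: "0 < j"
  shows "real K * (cut (level_set a j) (V - level_set a j) - 2 * cut (level a j) (level a (j - 1)))
     \<le> (\<Sum>v\<in>level_set a j. \<Sum>u\<in>V - level_set a j. flow a v u)"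
proof -
  let ?S = "level_set a j" let ?z = "\<lambda>v u. if v \<in> level a j \<and> u \<in> level a (j - 1) then wt v u else 0"
  have SV: "?S \<subseteq> V" using level_set_subset[OF I j] .
  \<comment> \<open>A nonresidual pair carries the full capacity outwards. A residual pair leaving
    the level set joins level j to level j - 1; there only the bound -K is available, and K - 2K =
    -K explains the factor 2.\<close>
  have ge: "K * wt v u - 2 * (real K * ?z v u) \<le> flow a v u" if vu: "v \<in> ?S" "u \<in> V - ?S" for v u
  proof (cases "residual a v u")
    case True
    then have "lev a v \<le> lev a u + 1" using inv_lev_residual[OF I] by blast
    then have "v \<in> level a j \<and> u \<in> level a (j - 1)"
      using vu SV unfolding level_set_def level_def by auto
    then show ?thesis using flow_ge[OF I, of v u] by simp
  next
    case False
    then have "flow a v u \<ge> K * wt v u"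
    proof (cases "{v, u} \<in> E")
      case True
      with False show ?thesis by (simp add: residual_def flow_def wt_def)
    next
      case f: False
      then have "\<not> 0 < psh a v u" "\<not> 0 < psh a u v"
        using inv_support[OF I, of v u] inv_support[OF I, of u v] by (auto simp: insert_commute)
      with f show ?thesis by (simp add: flow_def wt_def)
    qed
    moreover have "0 \<le> 2 * (real K * ?z v u)" by simp
    ultimately show ?thesis by linarith
  qed
  have "(\<Sum>u\<in>V - ?S. ?z v u) = (if v \<in> level a j then \<Sum>u\<in>level a (j - 1). wt v u else 0)" for v
  proof -
    have "(V - ?S) \<inter> level a (j - 1) = level a (j - 1)"
      using j unfolding level_set_def level_def by auto
    then show ?thesis
      using sum.inter_restrict[of "V - ?S" "wt v" "level a (j - 1)"] by auto
  qed
  moreover have "?S \<inter> level a j = level a j" unfolding level_set_def level_def by auto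
  ultimately have z: "(\<Sum>v\<in>?S. \<Sum>u\<in>V - ?S. ?z v u) = cut (level a j) (level a (j - 1))"
    using sum.inter_restrict[of ?S "\<lambda>v. \<Sum>u\<in>level a (j - 1). wt v u" "level a j"]
      finite_subset_V[OF SV] by (simp add: cut_def)
  have "real K * (cut ?S (V - ?S) - 2 * cut (level a j) (level a (j - 1)))
     = (\<Sum>v\<in>?S. \<Sum>u\<in>V - ?S. K * wt v u - 2 * (real K * ?z v u))"
    unfolding z[symmetric] unfolding cut_def
    by (simp only: sum_subtractf sum_distrib_left right_diff_distrib mult.assoc mult.left_commute[of "real K"])
  also have "\<dots> \<le> (\<Sum>v\<in>?S. \<Sum>u\<in>V - ?S. flow a v u)"
    using ge by (intro sum_mono)
  finally show ?thesis .
qed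

lemma level_subset: "level a j \<subseteq> V"
  by (auto simp: level_def)

lemma vol_level_set_step:
  assumes I: "inv a" and j: "0 < j"
  shows "vol E (level_set a j) = vol E (level_set a (Suc j)) + vol E (level a j)"
proof -
  have "level_set a j = level_set a (Suc j) \<union> level a j"
    using level_set_subset[OF I j] by (auto simp: level_set_def level_def)
  moreover have "level_set a (Suc j) \<inter> level a j = {}" by (auto simp: level_set_def level_def)
  ultimately show ?thesis
    using vol_disjoint_Un finite_subset_V level_set_subset[OF I] level_subset by (metis zero_less_Suc)
qed

end

section \<open>Geometric growth of volumes along the levels\<close>

lemma geometric_growth:
  fixes f :: "nat \<Rightarrow> real"
  assumes "\<And>i. i < n \<Longrightarrow> f (Suc i) > (1 + c) * f i" "0 \<le> c"
  shows "f n \<ge> (1 + c) ^ n * f 0"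
  using assms(1)
proof (induction n)
  case (Suc n)
  have "(1 + c) ^ Suc n * f 0 \<le> (1 + c) * f n"
    using Suc assms(2) by (simp add: mult.assoc mult_left_mono)
  also have "\<dots> \<le> f (Suc n)" using Suc.prems[of n] by simp
  finally show ?case .
qed simp

text \<open>By Bernoulli's inequality, 8k factors are enough for one doubling.\<close>

lemma power_ge_two_power:
  assumes "0 < k"
  shows "(2::real) ^ L \<le> (1 + 1 / (8 * real k)) ^ (8 * k * L)"
proof -
  have "2 \<le> (1 + 1 / (8 * real k)) ^ (8 * k)"
    using Bernoulli_inequality[of "1 / (8 * real k)" "8 * k"] assms by (simp add: field_simps)
  then have "2 ^ L \<le> ((1 + 1 / (8 * real k)) ^ (8 * k)) ^ L" by (intro power_mono) auto
  then show ?thesis by (simp add: power_mult)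
qed

text \<open>The height leaves two disjoint blocks of 8kL steps between levels, one in the upper and
  one in the lower half. Growth by 1 + 1/(8k) per level multiplies a volume by at least 2^L, hence
  by at least p vol(A), within one block.\<close>

locale scaled_routing = routing +
  fixes k L :: nat
  assumes p_ge: "16 \<le> p" and k_pos: "0 < k" and K_eq: "K = (p - 8) * k"
    and h_eq: "h = 16 * k * L + 2" and L_ge: "p * vol E (set bs) \<le> 2 ^ L"
begin

text \<open>The volume of V is unknown to the program; p vol(bs) / 8 serves as a lower bound of it.\<close>

definition good_level :: "routing_state \<Rightarrow> nat \<Rightarrow> bool" where
  "good_level a j \<longleftrightarrow> 4 * k * cut (level_set a j) (V - level_set a j) \<le> 5 * vol E (level_set a j) \<and>
     32 * k * cut (level_set a j) (V - level_set a j)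
       \<le> 5 * (real p * vol E (set bs) - 8 * real (vol E (level_set a j)))"

text \<open>The proof compares \<open>D\<close>, the volume of the level set, with \<open>U\<close>,
  the substitute for the volume of its complement. If no level is sparse, a step down multiplies
  \<open>D\<close> while \<open>D\<close> is the smaller of the two, and a step up multiplies
  \<open>U\<close> while \<open>U\<close> is the smaller. The reason is that an edge between levels
  j and j - 1 is counted in the volume of both, so many such edges make both levels large.\<close>

lemma ex_sparse_level:
  assumes I: "inv a" and stuck: "tok a" "lev a (pos a) = h"
  shows "\<exists>j. 0 < j \<and> j \<le> h \<and> 8 * k * cut (level a j) (level a (j - 1))
    \<le> min (real (vol E (level_set a j))) (real p * vol E (set bs) / 8 - vol E (level_set a j))"
proof (rule ccontr)
  assume no: "\<not> ?thesis"
  define D where "D j = real (vol E (level_set a j))" for j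
  define U where "U j = real p * vol E (set bs) / 8 - D j" for j
  define z where "z j = cut (level a j) (level a (j - 1))" for j
  let ?c = "1 / (8 * real k)"
  have k: "real k > 0" using k_pos by simp
  have c0: "0 \<le> ?c" by simp
  have big: "z j > ?c * min (D j) (U j)" if "0 < j" "j \<le> h" for j
  proof -
    have "min (D j) (U j) < 8 * k * z j"
      using no that unfolding D_def U_def z_def by (meson not_le)
    then have "min (D j) (U j) / (8 * k) < z j" using k by (simp only: pos_divide_less_eq mult.commute)
    then show ?thesis by simp
  qed
  have Dstep: "D j = D (Suc j) + vol E (level a j)" if "0 < j" for j
    using vol_level_set_step[OF I that] by (simp add: D_def)
  have Dmono: "D j \<le> D i" if "0 < i" "i \<le> j" for i j
  proof -
    have "level_set a j \<subseteq> level_set a i" using that by (auto simp: level_set_def)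
    then show ?thesis unfolding D_def using vol_mono finite_subset_V level_set_subset[OF I that(1)] by simp
  qed
  have z1: "z j \<le> vol E (level a j)" and z2: "z j \<le> vol E (level a (j - 1))" for j
    unfolding z_def using cut_le_vol[OF level_subset level_subset] cut_commute by metis+
  have Dh: "D h \<ge> 1"
  proof -
    have "vol E {pos a} \<le> vol E (level_set a h)"
      using vol_mono finite_subset_V[OF level_set_subset[OF I h_pos]] stuck by (simp add: level_set_def)
    moreover have "vol E {pos a} \<ge> 1" using inv_tok[OF I stuck(1)] by (simp add: vol_def)
    ultimately show ?thesis by (simp add: D_def)
  qed
  \<comment> \<open>The unit under way is not absorbed; without it \<open>U\<close> could start from
    0 and would never grow.\<close>
  have U1: "8 * U j \<ge> 1" if "0 < j" for j
  proof -
    have "real (8 * vol E (level_set a j) + 1) \<le> real (p * vol E (set bs))"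
      using level_set_vol_le[OF I that] stuck by (intro of_nat_mono) simp
    then show ?thesis by (simp add: U_def D_def)
  qed
  have TL: "real p * vol E (set bs) \<le> 2 ^ L"
    using L_ge by (metis of_nat_le_iff of_nat_mult of_nat_numeral of_nat_power)
  define X where "X = (1 + ?c) ^ (8 * k * L)"
  have X: "2 ^ L \<le> X" "0 \<le> X" using power_ge_two_power[OF k_pos, of L] by (simp_all add: X_def)
  \<comment> \<open>\<open>D\<close> decreases with the level, so the outcome of the comparison at
    this middle level carries over to all higher or to all lower levels.\<close>
  let ?m = "8 * k * L + 1"
  show False
  proof (cases "D ?m \<le> U ?m")
    case True
    let ?f = "\<lambda>i. D (h - i)"
    define n where "n = h - 8 * k * L"
    have "?f (Suc i) > (1 + ?c) * ?f i" if i: "i < 8 * k * L" for i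
    proof -
      let ?j = "h - i"
      have j: "?m \<le> ?j" "Suc ?m \<le> ?j" "?j \<le> h" "0 < ?j" "h - Suc i = ?j - 1" "0 < ?j - 1" "Suc (?j - 1) = ?j"
        using i h_eq by auto
      have "D ?j \<le> U ?j" using Dmono[of ?m ?j] True j unfolding U_def by simp
      then have "z ?j > ?c * D ?j" using big[OF j(4,3)] by simp
      moreover have "D (?j - 1) = D ?j + vol E (level a (?j - 1))" using Dstep[OF j(6)] j(7) by simp
      ultimately have "D ?j + ?c * D ?j < D (?j - 1)" using z2[of ?j] by linarith
      then show ?thesis by (simp only: j(5) distrib_right mult_1_left)
    qed
    from geometric_growth[where n = "8 * k * L" and f = ?f, OF this c0] have "X * D h \<le> D n" by (simp add: X_def n_def)
    moreover have "X * 1 \<le> X * D h"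
      using Dh X by (intro mult_left_mono) auto
    moreover have "8 * D n + 1 \<le> real p * vol E (set bs)"
      using U1[of n] by (simp add: h_eq n_def U_def)
    moreover have "0 \<le> D n" by (simp add: D_def)
    ultimately show False using TL X unfolding U_def by linarith
  next
    case False
    let ?f = "\<lambda>i. U (Suc i)"
    have "?f (Suc i) > (1 + ?c) * ?f i" if i: "i < 8 * k * L" for i
    proof -
      let ?j = "Suc i"
      have "D ?m \<le> D ?j" using i by (intro Dmono) auto
      then have "U ?j \<le> D ?j" using False unfolding U_def by simp
      then have "z ?j > ?c * U ?j" using big[of ?j] i h_eq by simp
      moreover have "U (Suc ?j) = U ?j + vol E (level a ?j)" using Dstep[of ?j] by (simp add: U_def)
      ultimately have "U ?j + ?c * U ?j < U (Suc ?j)" using z1[of ?j] by linarith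
      then show ?thesis by (simp only: distrib_right mult_1_left)
    qed
    from geometric_growth[where n = "8 * k * L" and f = ?f, OF this c0] have "X * U 1 \<le> U ?m" by (simp add: X_def)
    moreover have "X * (1 / 8) \<le> X * U 1"
      using U1[of 1] X by (intro mult_left_mono) auto
    moreover have "D ?m \<ge> 1" using Dmono[of ?m h] Dh h_eq by simp
    ultimately show False using TL X unfolding U_def by linarith
  qed
qed

lemma ex_good_level:
  assumes I: "inv a" and stuck: "tok a" "lev a (pos a) = h"
  shows "\<exists>j. 0 < j \<and> j \<le> h \<and> good_level a j"
proof -
  obtain j where j: "0 < j" "j \<le> h" and z: "8 * k * cut (level a j) (level a (j - 1))
    \<le> min (real (vol E (level_set a j))) (real p * vol E (set bs) / 8 - vol E (level_set a j))"
    using ex_sparse_level[OF assms] by blast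
  let ?S = "level_set a j"
  have SV: "?S \<subseteq> V" using level_set_subset[OF I j(1)] .
  define z where "z = cut (level a j) (level a (j - 1))"
  define c where "c = cut ?S (V - ?S)"
  define x where "x = real (vol E (set bs \<inter> ?S))"
  define D where "D = real (vol E ?S)"
  define B where "B = real (vol E (set bs))"
  have pos: "pos a \<in> ?S" using stuck j by (simp add: level_set_def)
  have "x \<le> D" unfolding x_def D_def
    using vol_mono[OF finite_subset_V[OF SV]] by simp
  have "x \<le> B" unfolding x_def B_def using vol_mono by simp
  have "real K * (c - 2 * z) \<le> (\<Sum>v\<in>?S. \<Sum>u\<in>V - ?S. flow a v u)"
    unfolding c_def z_def using level_set_outflow[OF I j(1)] .
  also have "\<dots> = real (\<Sum>v\<in>?S. inj a v) - real (\<Sum>v\<in>?S. absd a v) - 1"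
    using net_outflow[OF I SV] stuck pos by simp
  also have "real (\<Sum>v\<in>?S. inj a v) \<le> real (p * vol E (set bs \<inter> ?S))"
    using sum_inj_le[OF I SV] by (rule of_nat_mono)
  also have "(\<Sum>v\<in>?S. absd a v) = 8 * vol E ?S"
    using level_set_full[OF I j(1)] by (simp add: vol_def sum_distrib_left)
  finally have A: "real K * (c - 2 * z) \<le> real p * x - 8 * D"
    by (simp add: x_def D_def)
  define q where "q = real p - 8"
  have q: "q \<ge> 8" using p_ge by (simp add: q_def)
  have Kq: "real K = q * k" using K_eq p_ge by (simp add: q_def of_nat_diff)
  have "8 * B \<le> q * B" using q by (intro mult_right_mono) (auto simp: B_def)
  have W: "8 * D \<le> real p * B"
  proof -
    have "real (8 * vol E ?S) \<le> real (p * vol E (set bs))"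
      using level_set_vol_le[OF I j(1)] by (intro of_nat_mono) simp
    then show ?thesis by (simp add: D_def B_def)
  qed
  have px: "real p * x = q * x + 8 * x" "real p * B = q * B + 8 * B" by (simp_all add: q_def algebra_simps)
  have A': "q * (k * (c - 2 * z)) \<le> q * x + 8 * x - 8 * D" using A Kq px by (simp add: mult.assoc)
  \<comment> \<open>The net outflow is at most p x - 8 D \<le> (p - 8) D, and the factor p - 8 of
    the capacity cancels.\<close>
  have "q * (k * (c - 2 * z)) \<le> q * D"
    using A' \<open>x \<le> D\<close> mult_left_mono[of x D q] q by linarith
  then have c1: "k * (c - 2 * z) \<le> D" using q by simp
  \<comment> \<open>The same bound with the substitute for the volume of the complement. Either the
    net outflow is bounded by 0, or q \<ge> 8 is enough, which is where p \<ge> 16 is spent.\<close>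
  have "q * (k * (c - 2 * z)) \<le> q * (real p * B / 8 - D)"
  proof (cases "q * x + 8 * x - 8 * D \<le> 0")
    case True
    moreover have "0 \<le> q * (real p * B / 8 - D)" using W q by (intro mult_nonneg_nonneg) auto
    ultimately show ?thesis using A' by linarith
  next
    case False
    \<comment> \<open>Here D is at most p x / 8, and (q - 8) (p x / 8 - D) is nonnegative.\<close>
    have "0 \<le> (q - 8) * (q * x + 8 * x - 8 * D)" using False q by (intro mult_nonneg_nonneg) auto
    moreover have "q * (q + 8) * x \<le> q * (q + 8) * B" using \<open>x \<le> B\<close> q by (intro mult_left_mono) auto
    ultimately have "8 * (q * x + 8 * x - 8 * D) \<le> q * (q * B + 8 * B - 8 * D)"
      by (simp add: algebra_simps)
    also have "\<dots> = 8 * (q * ((q * B + 8 * B) / 8 - D))" by (simp add: field_simps)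
    finally have "q * x + 8 * x - 8 * D \<le> q * ((q * B + 8 * B) / 8 - D)"
      by (rule mult_left_le_imp_le) simp
    then show ?thesis using A' px by simp
  qed
  then have c2: "k * (c - 2 * z) \<le> real p * B / 8 - D" using q by simp
  \<comment> \<open>The sparse level adds 2 k z, at most a quarter of either bound, so k c is at
    most 5/4 of it.\<close>
  have "8 * k * z \<le> D" "8 * k * z \<le> real p * B / 8 - D"
    using z unfolding z_def D_def B_def by auto
  moreover have "k * (c - 2 * z) = k * c - 2 * (k * z)" by (simp add: algebra_simps)
  ultimately have "4 * (k * c) \<le> 5 * D" "4 * (k * c) \<le> 5 * (real p * B / 8 - D)"
    using c1 c2 by (simp_all add: mult.assoc)
  then show ?thesis using j unfolding good_level_def c_def D_def B_def
    by (intro exI[of _ j]) (simp add: mult.assoc)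
qed

end


section \<open>Execution with a clock\<close>

primrec assigned :: "com \<Rightarrow> vname set" where
  "assigned Skip = {}"
| "assigned (Assign x e) = {x}"
| "assigned (Store a e e') = {}"
| "assigned (Seq c c') = assigned c \<union> assigned c'"
| "assigned (If b c c') = assigned c \<union> assigned c'"
| "assigned (While b c) = assigned c"

primrec stored :: "com \<Rightarrow> vname set" where
  "stored Skip = {}"
| "stored (Assign x e) = {}"
| "stored (Store a e e') = {a}"
| "stored (Seq c c') = stored c \<union> stored c'"
| "stored (If b c c') = stored c \<union> stored c'"
| "stored (While b c) = stored c"

definition frame :: "com \<Rightarrow> state \<Rightarrow> state \<Rightarrow> bool" where
  "frame c s s' \<longleftrightarrow> (\<forall>x. x \<notin> assigned c \<longrightarrow> vars s' x = vars s x) \<and> (\<forall>a. a \<notin> stored c \<longrightarrow> arrs s' a = arrs s a)"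

lemma exec_frame: "exec adj c s t s' \<Longrightarrow> frame c s s'"
  by (induction rule: exec.induct) (auto simp: frame_def)

text \<open>The first argument of a postcondition is a clock, started at T.\<close>

definition wp :: "(nat \<Rightarrow> nat list option) \<Rightarrow> com \<Rightarrow> (nat \<Rightarrow> state \<Rightarrow> bool) \<Rightarrow> nat \<Rightarrow> state \<Rightarrow> bool" where
  "wp adj c Q T s \<longleftrightarrow> (\<exists>t s'. exec adj c s t s' \<and> Q (T + t) s')"

inductive_cases exec_AssignE: "exec adj (Assign x e) s t s'"
inductive_cases exec_StoreE: "exec adj (Store a e e') s t s'"
inductive_cases exec_SeqE: "exec adj (Seq c c') s t s'"

lemma wp_exec: "exec adj c s t s' \<Longrightarrow> wp adj c Q T s \<longleftrightarrow> Q (T + t) s'"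
  unfolding wp_def by (metis exec_deterministic)

lemma wp_Skip: "wp adj Skip Q T s \<longleftrightarrow> Q (T + 1) s"
  by (rule wp_exec[OF exec.Skip])

lemma wp_Assign: "wp adj (Assign x e) Q T s \<longleftrightarrow>
    (case eval adj s e of None \<Rightarrow> False
     | Some v \<Rightarrow> Q (T + (1 + cost e)) (s\<lparr>vars := (vars s)(x := v)\<rparr>))"
proof (cases "eval adj s e")
  case None
  then show ?thesis by (auto simp: wp_def elim: exec_AssignE)
next
  case (Some v)
  from wp_exec[OF exec.Assign[where x = v, OF this]] show ?thesis using Some by simp
qed

lemma wp_Store: "wp adj (Store a e e') Q T s \<longleftrightarrow>
    (case Option.bind (eval adj s e) nat_of of None \<Rightarrow> False
     | Some i \<Rightarrow> (case eval adj s e' of None \<Rightarrow> False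
       | Some y \<Rightarrow> Q (T + (1 + cost e + cost e')) (s\<lparr>arrs := (arrs s)(a := (arrs s a)(i := y))\<rparr>)))"
  unfolding wp_def
  by (auto split: option.splits bind_splits elim!: exec_StoreE intro!: exec.Store exI)

lemma wp_Seq: "wp adj (Seq c c') Q T s \<longleftrightarrow> wp adj c (wp adj c' Q) T s"
proof
  assume "wp adj (Seq c c') Q T s"
  then show "wp adj c (wp adj c' Q) T s"
    unfolding wp_def by (metis exec_SeqE add.assoc)
next
  assume "wp adj c (wp adj c' Q) T s"
  then show "wp adj (Seq c c') Q T s"
    unfolding wp_def by (metis exec.Seq add.assoc)
qed

lemma wp_If: "wp adj (If b c c') Q T s \<longleftrightarrow>
    (case beval adj s b of None \<Rightarrow> False
     | Some v \<Rightarrow> wp adj (if v then c else c') Q (T + (1 + bcost b)) s)"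
proof
  assume "wp adj (If b c c') Q T s"
  then obtain t s' where e: "exec adj (If b c c') s t s'" and Q: "Q (T + t) s'"
    unfolding wp_def by blast
  from e show "case beval adj s b of None \<Rightarrow> False
     | Some v \<Rightarrow> wp adj (if v then c else c') Q (T + (1 + bcost b)) s"
    using Q by cases (auto simp: wp_def add.assoc)
next
  assume a: "case beval adj s b of None \<Rightarrow> False
     | Some v \<Rightarrow> wp adj (if v then c else c') Q (T + (1 + bcost b)) s"
  then obtain v t s' where v: "beval adj s b = Some v" and e: "exec adj (if v then c else c') s t s'"
      and Q: "Q (T + (1 + bcost b + t)) s'"
    by (auto simp: wp_def add.assoc split: option.splits)
  have "exec adj (If b c c') s (1 + bcost b + t) s'"
    using v e exec.IfTrue exec.IfFalse by (cases v) (metis (full_types))+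
  with Q show "wp adj (If b c c') Q T s" unfolding wp_def by blast
qed

lemma wp_conseq:
  assumes "wp adj c Q T s" "\<And>T s'. Q T s' \<Longrightarrow> frame c s s' \<Longrightarrow> Q' T s'"
  shows "wp adj c Q' T s"
  using assms exec_frame unfolding wp_def by metis

lemma wp_While_measure:
  fixes m :: "'g \<Rightarrow> nat"
  assumes "I g T s"
    and "\<And>g T s. I g T s \<Longrightarrow> \<exists>v. beval adj s b = Some v \<and>
      (if v then wp adj c (\<lambda>T' s'. \<exists>g'. I g' T' s' \<and> m g' < m g) (T + (1 + bcost b)) s
       else Q (T + (1 + bcost b)) s)"
  shows "wp adj (While b c) Q T s"
  using assms(1)
proof (induction "m g" arbitrary: g T s rule: less_induct)
  case less
  obtain v where v: "beval adj s b = Some v" "if v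
      then wp adj c (\<lambda>T' s'. \<exists>g'. I g' T' s' \<and> m g' < m g) (T + (1 + bcost b)) s
      else Q (T + (1 + bcost b)) s"
    using assms(2)[OF less.prems] by blast
  show ?case
  proof (cases v)
    case True
    with v obtain t s' g' where c: "exec adj c s t s'" and g: "I g' (T + (1 + bcost b) + t) s'" "m g' < m g"
      unfolding wp_def by auto
    from less.hyps[OF g(2,1)] obtain t' s'' where
      "exec adj (While b c) s' t' s''" "Q (T + (1 + bcost b) + t + t') s''"
      unfolding wp_def by blast
    moreover have "beval adj s b = Some True" using v(1) True by simp
    from exec.WhileTrue[OF this c] calculation(1)
    have "exec adj (While b c) s (1 + bcost b + t + t') s''" by blast
    ultimately show ?thesis unfolding wp_def by (metis add.assoc)
  next
    case False
    with v show ?thesis unfolding wp_def using exec.WhileFalse by fastforce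
  qed
qed

lemma frame_trans: "frame c s s' \<Longrightarrow> frame c s' s'' \<Longrightarrow> frame c s s''"
  by (auto simp: frame_def)

text \<open>\<open>g\<close> is a ghost value on which the invariant depends, and \<open>m\<close>
  is its decreasing measure. The step case is given the frame of the loop relative to the initial
  state, so an invariant lists only what the body changes.\<close>

lemma wp_While:
  fixes m :: "'g \<Rightarrow> nat"
  assumes I: "I g T s"
    and step: "\<And>g T s'. I g T s' \<Longrightarrow> frame c s s' \<Longrightarrow> \<exists>v. beval adj s' b = Some v \<and>
      (if v then wp adj c (\<lambda>T' s''. \<exists>g'. I g' T' s'' \<and> m g' < m g) (T + (1 + bcost b)) s'
       else Q (T + (1 + bcost b)) s')"
  shows "wp adj (While b c) Q T s"
proof (rule wp_While_measure[where I = "\<lambda>g T s'. I g T s' \<and> frame c s s'" and m = m and g = g])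
  show "I g T s \<and> frame c s s" using I by (simp add: frame_def)
next
  fix g T s' assume a: "I g T s' \<and> frame c s s'"
  from step[of g T s'] a obtain v where v: "beval adj s' b = Some v"
    "if v then wp adj c (\<lambda>T' s''. \<exists>g'. I g' T' s'' \<and> m g' < m g) (T + (1 + bcost b)) s'
       else Q (T + (1 + bcost b)) s'"
    by blast
  have "wp adj c (\<lambda>T' s''. \<exists>g'. (I g' T' s'' \<and> frame c s s'') \<and> m g' < m g) (T + (1 + bcost b)) s'"
    if v
    by (rule wp_conseq[of _ _ "\<lambda>T' s''. \<exists>g'. I g' T' s'' \<and> m g' < m g"])
       (use v that a frame_trans in auto)
  with v show "\<exists>v. beval adj s' b = Some v \<and>
      (if v then wp adj c (\<lambda>T' s''. \<exists>g'. (I g' T' s'' \<and> frame c s s'') \<and> m g' < m g) (T + (1 + bcost b)) s'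
       else Q (T + (1 + bcost b)) s')"
    by auto
qed

lemmas wp_simps = wp_Skip wp_Assign wp_Store wp_Seq wp_If

lemma nat_of_real [simp]: "nat_of (real n) = Some n"
  by (simp add: nat_of_def)

section \<open>Pairing of numbers for array addresses\<close>

definition pcode :: "nat \<Rightarrow> nat \<Rightarrow> nat" where
  "pcode a b = (a + b) * (a + b) + a"

text \<open>The code lies between the squares of a + b and a + b + 1, so it determines a + b and
  then a.\<close>

lemma pcode_eq_iff [simp]: "pcode a b = pcode c d \<longleftrightarrow> a = c \<and> b = d"
proof
  have less: "pcode a b < pcode c d" if "a + b < c + d" for a b c d
  proof -
    have "Suc (a + b) * Suc (a + b) \<le> (c + d) * (c + d)"
      using that by (intro mult_le_mono) auto
    then show ?thesis unfolding pcode_def by simp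
  qed
  assume e: "pcode a b = pcode c d"
  then have "a + b = c + d" using less[of a b c d] less[of c d a b] by (metis nat_neq_iff)
  with e show "a = c \<and> b = d" by (simp add: pcode_def)
qed simp

definition pair :: "exp \<Rightarrow> exp \<Rightarrow> exp" where
  "pair e e' = Plus (Times (Plus e e') (Plus e e')) e"

definition rpcode :: "real \<Rightarrow> real \<Rightarrow> real" where
  "rpcode x y = (x + y) * (x + y) + x"

lemma rpcode_real [simp]: "rpcode (real a) (real b) = real (pcode a b)"
  by (simp add: rpcode_def pcode_def)

lemma eval_pair [simp]: "eval adj s (pair e e') = do {x \<leftarrow> eval adj s e; y \<leftarrow> eval adj s e'; Some (rpcode x y)}"
  by (cases "eval adj s e"; cases "eval adj s e'") (simp_all add: pair_def rpcode_def)

lemma cost_pair [simp]: "cost (pair e e') = 4 + 3 * cost e + 2 * cost e'"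
  by (simp add: pair_def)


section \<open>The routing program\<close>

abbreviation seq :: "com \<Rightarrow> com \<Rightarrow> com"  (infixr ";;" 60) where
  "c ;; c' \<equiv> Seq c c'"

text \<open>Every value of k uses its own cells of the arrays, so that they need not be cleared.\<close>

definition cell :: "vname \<Rightarrow> exp \<Rightarrow> exp" where
  "cell a e = Elem a (pair (Var ''k'') e)"

definition set_cell :: "vname \<Rightarrow> exp \<Rightarrow> exp \<Rightarrow> com" where
  "set_cell a e e' = Store a (pair (Var ''k'') e) e'"

definition incr :: "vname \<Rightarrow> com" where
  "incr x = Assign x (Plus (Var x) (Const 1))"

text \<open>\<open>B\<close> lists the non-isolated vertices of A, \<open>x\<close> is the position of the current unit and \<open>on\<close> tells
  whether there is one; \<open>lst\<close> records the vertices with a positive label, so that the level sets can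
  be listed later on.\<close>

definition route_body :: com where
  "route_body =
    If (Equal (Var ''on'') (Const 0))
      (Assign ''y'' (Elem ''B'' (Var ''i'')) ;;
       If (Less (cell ''inj'' (Var ''y'')) (Times (Var ''p'') (Deg (Var ''y''))))
         (set_cell ''inj'' (Var ''y'') (Plus (cell ''inj'' (Var ''y'')) (Const 1)) ;;
          Assign ''x'' (Var ''y'') ;; Assign ''on'' (Const 1))
         (incr ''i''))
      (If (Less (cell ''ab'' (Var ''x'')) (Times (Const 8) (Deg (Var ''x''))))
         (set_cell ''ab'' (Var ''x'') (Plus (cell ''ab'' (Var ''x'')) (Const 1)) ;;
          Assign ''on'' (Const 0))
         (If (Less (cell ''cur'' (Var ''x'')) (Deg (Var ''x'')))
            (Assign ''y'' (Nbr (Var ''x'') (cell ''cur'' (Var ''x''))) ;;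
             If (And (Less (cell ''g'' (pair (Var ''x'') (Var ''y'')))
                           (Plus (Var ''K'') (cell ''g'' (pair (Var ''y'') (Var ''x'')))))
                     (Equal (cell ''l'' (Var ''x'')) (Plus (cell ''l'' (Var ''y'')) (Const 1))))
               (set_cell ''g'' (pair (Var ''x'') (Var ''y''))
                  (Plus (cell ''g'' (pair (Var ''x'') (Var ''y''))) (Const 1)) ;;
                Assign ''x'' (Var ''y''))
               (set_cell ''cur'' (Var ''x'') (Plus (cell ''cur'' (Var ''x'')) (Const 1))))
            (If (Equal (cell ''l'' (Var ''x'')) (Const 0))
               (Store ''lst'' (Var ''m'') (Var ''x'') ;; incr ''m'') Skip ;;
             set_cell ''l'' (Var ''x'') (Plus (cell ''l'' (Var ''x'')) (Const 1)) ;;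
             set_cell ''cur'' (Var ''x'') (Const 0))))"

definition route :: com where
  "route = While (And (Less (cell ''l'' (Var ''x'')) (Var ''h''))
                      (Not (And (Equal (Var ''on'') (Const 0)) (Not (Less (Var ''i'') (Var ''nb''))))))
             route_body"

definition repr :: "nat \<Rightarrow> state \<Rightarrow> routing_state \<Rightarrow> bool" where
  "repr k s a \<longleftrightarrow>
     vars s ''i'' = real (src a) \<and> vars s ''x'' = real (pos a) \<and>
     vars s ''on'' = (if tok a then 1 else 0) \<and> vars s ''m'' = real (length (lst a)) \<and>
     (\<forall>i<length (lst a). arrs s ''lst'' i = real (lst a ! i)) \<and>
     (\<forall>v. arrs s ''l'' (pcode k v) = real (lev a v)) \<and>
     (\<forall>v. arrs s ''cur'' (pcode k v) = real (cur a v)) \<and>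
     (\<forall>v. arrs s ''ab'' (pcode k v) = real (absd a v)) \<and>
     (\<forall>v. arrs s ''inj'' (pcode k v) = real (inj a v)) \<and>
     (\<forall>u v. arrs s ''g'' (pcode k (pcode u v)) = real (psh a u v))"

text \<open>Quantified over all later values, because k only grows: a phase dirties the cells of its
  own k and leaves those of the next one fresh.\<close>

definition zeroed :: "nat \<Rightarrow> state \<Rightarrow> bool" where
  "zeroed k s \<longleftrightarrow> (\<forall>k'\<ge>k. \<forall>v. \<forall>a\<in>{''l'', ''cur'', ''ab'', ''inj'', ''g''}. arrs s a (pcode k' v) = 0)"

context routing begin

definition params :: "nat \<Rightarrow> state \<Rightarrow> bool" where
  "params k s \<longleftrightarrow> vars s ''k'' = real k \<and> vars s ''p'' = real p \<and> vars s ''K'' = real K \<and>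
     vars s ''h'' = real h \<and> vars s ''nb'' = real (length bs) \<and>
     (\<forall>i<length bs. arrs s ''B'' i = real (bs ! i))"

text \<open>One pass performs one \<open>step\<close>. Its writes to the arrays of
  \<open>zeroed\<close> go to addresses with first component k, so injectivity of
  \<open>pcode\<close> protects the cells of later phases. The number 500 is a generous bound for
  the costliest branch.\<close>

lemma route_body_correct:
  assumes R: "repr k s a" and P: "params k s" and Z: "zeroed (Suc k) s" and I: "inv a" and run: "running a"
  shows "wp adj route_body (\<lambda>T' s'. repr k s' (step a) \<and> params k s' \<and> zeroed (Suc k) s' \<and> T' \<le> T + 500) T s"
proof (cases "tok a")
  case False
  then have src: "src a < length bs" using run by (simp add: running_def)
  let ?v = "bs ! src a"
  have v: "?v \<in> V" using bs src by auto
  have c: "real (inj a ?v) < real p * real (degree E ?v) \<longleftrightarrow> inj a ?v < p * degree E ?v"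
    by (metis of_nat_less_iff of_nat_mult)
  show ?thesis
    using R P Z False src v c unfolding route_body_def step_def repr_def params_def
    by (cases "inj a ?v < p * degree E ?v")
      (simp_all add: wp_simps cell_def set_cell_def incr_def adj_eq length_nbrs Let_def zeroed_def)
next
  case True
  let ?x = "pos a"
  have x: "?x \<in> V" using inv_tok[OF I True] by blast
  have c: "real (absd a ?x) < 8 * real (degree E ?x) \<longleftrightarrow> absd a ?x < 8 * degree E ?x"
    by (metis of_nat_less_iff of_nat_mult of_nat_numeral)
  show ?thesis
  proof (cases "absd a ?x < 8 * degree E ?x")
    case ab: True
    show ?thesis
      using R P Z True x c ab unfolding route_body_def step_def repr_def params_def
      by (simp add: wp_simps cell_def set_cell_def incr_def adj_eq length_nbrs Let_def zeroed_def)
  next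
    case ab: False
    show ?thesis
    proof (cases "cur a ?x < degree E ?x")
      case cu: True
      let ?u = "nbrs ?x ! cur a ?x"
      have c1: "real (psh a ?x ?u) < real K + real (psh a ?u ?x) \<longleftrightarrow> psh a ?x ?u < K + psh a ?u ?x"
        by (metis of_nat_less_iff of_nat_add)
      have c2: "real (lev a ?x) = real (lev a ?u) + 1 \<longleftrightarrow> lev a ?x = lev a ?u + 1"
        by (metis of_nat_eq_iff of_nat_add of_nat_1)
      show ?thesis
        using R P Z True x c ab cu c1 c2 unfolding route_body_def step_def repr_def params_def
        by (cases "psh a ?x ?u < K + psh a ?u ?x \<and> lev a ?x = lev a ?u + 1")
          (simp_all add: wp_simps cell_def set_cell_def incr_def adj_eq length_nbrs Let_def zeroed_def)
    next
      case cu: False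
      show ?thesis
        using R P Z True x c ab cu unfolding route_body_def step_def repr_def params_def
        by (cases "lev a ?x = 0")
          (simp_all add: wp_simps cell_def set_cell_def incr_def adj_eq length_nbrs Let_def zeroed_def nth_append less_Suc_eq)
    qed
  qed
qed

end

context routing begin

text \<open>\<open>work\<close> serves both as clock and as measure: each iteration takes at most
  600 steps and raises \<open>work\<close> by at least 1, and \<open>work_le\<close> caps
  it.\<close>

lemma route_correct:
  assumes R: "repr k s empty_routing" and P: "params k s" and Z: "zeroed (Suc k) s"
  shows "wp adj route (\<lambda>T' s'. \<exists>a. repr k s' a \<and> inv a \<and> \<not> running a \<and> params k s' \<and> zeroed (Suc k) s' \<and>
    int T' \<le> int T + 600 * (6 * int h * int (p * vol E (set bs)) + int (length bs) + int h + 1)) T s"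
proof -
  define W where "W = 6 * int h * int (p * vol E (set bs)) + int (length bs) + int h"
  let ?I = "\<lambda>a T' s'. repr k s' a \<and> inv a \<and> params k s' \<and> zeroed (Suc k) s' \<and> int T' \<le> int T + 600 * work a"
  have W: "work a \<le> W" if "inv a" for a unfolding W_def using work_le[OF that] .
  show ?thesis unfolding route_def
  proof (rule wp_While[where I = ?I and m = "\<lambda>a. nat (W - work a)" and g = empty_routing], goal_cases)
    case 1
    have "0 \<le> work empty_routing" by (simp add: work_def empty_routing_def)
    then show ?case using R P Z inv_empty by simp
  next
    case (2 a T' s')
    then have I: "repr k s' a" "inv a" "params k s'" "zeroed (Suc k) s'" "int T' \<le> int T + 600 * work a" by auto
    let ?b = "And (Less (cell ''l'' (Var ''x'')) (Var ''h''))
       (Not (And (Equal (Var ''on'') (Const 0)) (Not (Less (Var ''i'') (Var ''nb'')))))"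
    have b: "beval adj s' ?b = Some (running a)"
      using I unfolding repr_def params_def running_def by (simp add: cell_def)
    have c: "1 + bcost ?b \<le> 50" by (simp add: cell_def)
    show ?case
    proof (cases "running a")
      case True
      have "wp adj route_body (\<lambda>T'' s''. \<exists>g'. ?I g' T'' s'' \<and> nat (W - work g') < nat (W - work a)) (T' + (1 + bcost ?b)) s'"
      proof (rule wp_conseq[OF route_body_correct[OF I(1,3,4,2) True]], intro exI[of _ "step a"])
        fix T'' s'' assume q: "repr k s'' (step a) \<and> params k s'' \<and> zeroed (Suc k) s'' \<and> T'' \<le> T' + (1 + bcost ?b) + 500"
        have "inv (step a)" using inv_step[OF I(2) True] .
        moreover have "work a < work (step a)" using work_step[OF I(2) True] .
        moreover have "work (step a) \<le> W" using W calculation(1) by blast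
        moreover have "int T'' \<le> int T + 600 * work (step a)"
          using q c I(5) calculation(2) by linarith
        ultimately show "?I (step a) T'' s'' \<and> nat (W - work (step a)) < nat (W - work a)"
          using q by simp
      qed
      then show ?thesis using b True by (intro exI[of _ True]) simp
    next
      case False
      have "int (T' + (1 + bcost ?b)) \<le> int (T' + 50)"
        using of_nat_mono[OF add_left_mono[OF c, of T']] .
      also have "\<dots> \<le> int T + 600 * (W + 1)" using I(5) W[OF I(2)] by simp
      finally have "int (T' + (1 + bcost ?b)) \<le> int T + 600 * (W + 1)" .
      then have "repr k s' a \<and> inv a \<and> \<not> running a \<and> params k s' \<and> zeroed (Suc k) s' \<and>
          int (T' + (1 + bcost ?b)) \<le> int T + 600 * (W + 1)"
        using I False by blast
      then show ?thesis unfolding W_def using b False by (intro exI[of _ False]) (simp only: if_False, blast)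
    qed
  qed
qed

end


section \<open>The sweep over the level sets\<close>

definition count_body :: com where
  "count_body = If (Less (cell ''l'' (Nbr (Var ''y'') (Var ''e''))) (Var ''j'')) (incr ''cu'') Skip ;; incr ''e''"

definition count :: com where
  "count = While (Less (Var ''e'') (Deg (Var ''y''))) count_body"

definition append_vertex :: com where
  "append_vertex = Store ''S'' (Var ''S'') (Var ''y'') ;; incr ''S'' ;;
     Assign ''vo'' (Plus (Var ''vo'') (Deg (Var ''y''))) ;; Assign ''e'' (Const 0)"

definition collect_body :: com where
  "collect_body =
     Assign ''y'' (Elem ''lst'' (Var ''r'')) ;;
     If (Less (cell ''l'' (Var ''y'')) (Var ''j'')) Skip (append_vertex ;; count) ;;
     incr ''r''"

definition collect :: com where
  "collect = While (Less (Var ''r'') (Var ''m'')) collect_body"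

context local_graph begin

definition count_low :: "(nat \<Rightarrow> nat) \<Rightarrow> nat \<Rightarrow> nat \<Rightarrow> nat" where
  "count_low f j v = length (filter (\<lambda>u. f u < j) (nbrs v))"

lemma count_correct:
  assumes v: "v \<in> V" "vars s ''y'' = real v" and e: "vars s ''e'' = 0" and c: "vars s ''cu'' = real c"
    and j: "vars s ''j'' = real j" "vars s ''k'' = real k" "\<forall>u. arrs s ''l'' (pcode k u) = real (f u)"
  shows "wp adj count (\<lambda>T' s'. vars s' ''cu'' = real (c + count_low f j v) \<and>
    T' \<le> T + 100 * (degree E v + 1)) T s"
proof -
  let ?J = "\<lambda>n T' s'. n \<le> degree E v \<and> vars s' ''e'' = real n \<and>
     vars s' ''cu'' = real (c + length (filter (\<lambda>u. f u < j) (take n (nbrs v)))) \<and> T' \<le> T + 100 * n"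
  let ?b = "Less (Var ''e'') (Deg (Var ''y''))"
  show ?thesis
    unfolding count_def
  proof (rule wp_While[where m = "\<lambda>n. degree E v - n" and g = "0::nat" and I = ?J], goal_cases)
    case 1
    then show ?case using e c by simp
  next
    case (2 n T' s')
    then have eq: "vars s' ''y'' = real v" "vars s' ''j'' = real j" "vars s' ''k'' = real k"
        "\<forall>u. arrs s' ''l'' (pcode k u) = real (f u)"
      using v j by (simp_all add: frame_def count_body_def incr_def)
    show ?case
    proof (cases "n < degree E v")
      case True
      let ?u = "nbrs v ! n"
      have t: "take (Suc n) (nbrs v) = take n (nbrs v) @ [?u]"
        using True v length_nbrs by (simp add: take_Suc_conv_app_nth)
      have "wp adj count_body (?J (Suc n)) (T' + (1 + bcost ?b)) s'"
        using 2(1) eq True v(1) t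
        by (cases "f ?u < j") (simp_all add: adj_eq length_nbrs count_body_def wp_simps cell_def incr_def)
      then have "wp adj count_body (\<lambda>T'' s''. \<exists>n'. ?J n' T'' s'' \<and> degree E v - n' < degree E v - n)
          (T' + (1 + bcost ?b)) s'"
        by (rule wp_conseq) (use True in \<open>auto intro!: exI[of _ "Suc n"]\<close>)
      moreover have "beval adj s' ?b = Some True" using 2(1) eq True v by (simp add: adj_eq length_nbrs)
      ultimately show ?thesis by auto
    next
      case False
      then have "n = degree E v" using 2 by simp
      then show ?thesis using 2(1) eq v by (intro exI[of _ False]) (simp add: adj_eq length_nbrs count_low_def)
    qed
  qed
qed

definition collected :: "(nat \<Rightarrow> nat) \<Rightarrow> nat \<Rightarrow> nat list \<Rightarrow> state \<Rightarrow> bool" where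
  "collected f j xs s \<longleftrightarrow> vars s ''S'' = real (length xs) \<and> (\<forall>i<length xs. arrs s ''S'' i = real (xs ! i)) \<and>
     vars s ''vo'' = real (\<Sum>v\<leftarrow>xs. degree E v) \<and> vars s ''cu'' = real (\<Sum>v\<leftarrow>xs. count_low f j v)"

lemma collect_body_correct:
  assumes C: "collected f j (filter (\<lambda>v. j \<le> f v) (take n ls)) s" and n: "n < length ls" "ls ! n \<in> V"
    and s: "vars s ''r'' = real n" "vars s ''j'' = real j" "vars s ''k'' = real k"
      "\<forall>i<length ls. arrs s ''lst'' i = real (ls ! i)" "\<forall>u. arrs s ''l'' (pcode k u) = real (f u)"
  shows "wp adj collect_body (\<lambda>T' s'. collected f j (filter (\<lambda>v. j \<le> f v) (take (Suc n) ls)) s' \<and>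
    vars s' ''r'' = real (Suc n) \<and> T' \<le> T + 100 * degree E (ls ! n) + 300) T s"
proof -
  let ?v = "ls ! n"
  have t: "take (Suc n) ls = take n ls @ [?v]" using n by (simp add: take_Suc_conv_app_nth)
  show ?thesis
  proof (cases "f ?v < j")
    case True
    then have x: "filter (\<lambda>v. j \<le> f v) (take (Suc n) ls) = filter (\<lambda>v. j \<le> f v) (take n ls)"
      using t by simp
    show ?thesis unfolding x using C n s True
      by (simp add: collected_def collect_body_def wp_simps cell_def incr_def)
  next
    case False
    let ?xs = "filter (\<lambda>v. j \<le> f v) (take n ls)"
    let ?c = "(\<Sum>v\<leftarrow>?xs. count_low f j v)"
    have x: "filter (\<lambda>v. j \<le> f v) (take (Suc n) ls) = ?xs @ [?v]" using t False by simp
    \<comment> \<open>Stated for an arbitrary clock and state, so that it applies to the state that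
      symbolic execution of the test produces below.\<close>
    have *: "wp adj (append_vertex ;; count) (\<lambda>T' s'. collected f j (?xs @ [?v]) s' \<and>
        vars s' ''r'' = real n \<and> T' \<le> T1 + 100 * degree E ?v + 200) T1 s1"
      if 1: "collected f j ?xs s1" "vars s1 ''r'' = real n" "vars s1 ''j'' = real j" "vars s1 ''k'' = real k"
        "\<forall>u. arrs s1 ''l'' (pcode k u) = real (f u)" "vars s1 ''y'' = real ?v" for T1 s1
    proof -
      have "wp adj append_vertex (\<lambda>T' s'. vars s' ''S'' = real (length (?xs @ [?v])) \<and>
          (\<forall>i<length (?xs @ [?v]). arrs s' ''S'' i = real ((?xs @ [?v]) ! i)) \<and>
          vars s' ''vo'' = real (\<Sum>v\<leftarrow>?xs @ [?v]. degree E v) \<and> vars s' ''cu'' = real ?c \<and>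
          vars s' ''y'' = real ?v \<and> vars s' ''e'' = 0 \<and> vars s' ''j'' = real j \<and> vars s' ''k'' = real k \<and>
          (\<forall>u. arrs s' ''l'' (pcode k u) = real (f u)) \<and> vars s' ''r'' = real n \<and> T' \<le> T1 + 50) T1 s1"
        using 1 n unfolding collected_def
        by (simp add: append_vertex_def wp_simps incr_def adj_eq length_nbrs nth_append less_Suc_eq)
      then show ?thesis
        unfolding wp_Seq
      proof (rule wp_conseq, elim conjE, goal_cases)
        case (1 T2 s2)
        show ?case
        proof (rule wp_conseq[OF count_correct[OF n(2) 1(7,8,6,9,10,11)]], goal_cases)
          case (1 T3 s3)
          then have "vars s3 ''S'' = vars s2 ''S''" "arrs s3 ''S'' = arrs s2 ''S''" "vars s3 ''vo'' = vars s2 ''vo''"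
              "vars s3 ''r'' = vars s2 ''r''"
            by (simp_all add: frame_def count_def count_body_def incr_def)
          then show ?case
            using 1 \<open>T2 \<le> T1 + 50\<close> \<open>vars s2 ''S'' = _\<close> \<open>vars s2 ''vo'' = _\<close> \<open>vars s2 ''r'' = _\<close>
              \<open>\<forall>i<length (?xs @ [?v]). arrs s2 ''S'' i = _ i\<close>
            unfolding collected_def by simp
        qed
      qed
    qed
    show ?thesis
      unfolding collect_body_def x
      using C n s False
      apply (simp add: wp_Assign wp_Seq wp_If cell_def)
      apply (subst wp_Seq[symmetric])
      apply (rule wp_conseq[OF *])
            apply (simp_all add: collected_def wp_Assign incr_def)
      done
  qed
qed

lemma collect_correct:
  assumes C: "collected f j [] s" and ls: "set ls \<subseteq> V"
    and s: "vars s ''r'' = 0" "vars s ''j'' = real j" "vars s ''k'' = real k" "vars s ''m'' = real (length ls)"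
      "\<forall>i<length ls. arrs s ''lst'' i = real (ls ! i)" "\<forall>u. arrs s ''l'' (pcode k u) = real (f u)"
  shows "wp adj collect (\<lambda>T' s'. collected f j (filter (\<lambda>v. j \<le> f v) ls) s' \<and>
    T' \<le> T + 400 * (\<Sum>v\<leftarrow>ls. degree E v + 1) + 10) T s"
proof -
  let ?J = "\<lambda>n T' s'. n \<le> length ls \<and> vars s' ''r'' = real n \<and>
     collected f j (filter (\<lambda>v. j \<le> f v) (take n ls)) s' \<and>
     T' \<le> T + 400 * (\<Sum>v\<leftarrow>take n ls. degree E v + 1)"
  let ?b = "Less (Var ''r'') (Var ''m'')"
  show ?thesis
    unfolding collect_def
  proof (rule wp_While[where m = "\<lambda>n. length ls - n" and g = "0::nat" and I = ?J], goal_cases)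
    case 1
    then show ?case using C s by simp
  next
    case (2 n T' s')
    then have eq: "vars s' ''j'' = real j" "vars s' ''k'' = real k" "vars s' ''m'' = real (length ls)"
        "\<forall>i<length ls. arrs s' ''lst'' i = real (ls ! i)" "\<forall>u. arrs s' ''l'' (pcode k u) = real (f u)"
      using s by (simp_all add: frame_def collect_body_def append_vertex_def count_def count_body_def incr_def)
    show ?case
    proof (cases "n < length ls")
      case True
      have t: "take (Suc n) ls = take n ls @ [ls ! n]" using True by (simp add: take_Suc_conv_app_nth)
      have v: "ls ! n \<in> V" using True ls by auto
      have "wp adj collect_body (\<lambda>T'' s''. collected f j (filter (\<lambda>v. j \<le> f v) (take (Suc n) ls)) s'' \<and>
          vars s'' ''r'' = real (Suc n) \<and> T'' \<le> (T' + (1 + bcost ?b)) + 100 * degree E (ls ! n) + 300)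
          (T' + (1 + bcost ?b)) s'"
        by (rule collect_body_correct[where k = k]) (use 2(1) eq True v in auto)
      then have "wp adj collect_body (\<lambda>T'' s''. \<exists>n'. ?J n' T'' s'' \<and> length ls - n' < length ls - n)
          (T' + (1 + bcost ?b)) s'"
      proof (rule wp_conseq, intro exI[of _ "Suc n"])
        fix T'' s''
        assume "collected f j (filter (\<lambda>v. j \<le> f v) (take (Suc n) ls)) s'' \<and>
          vars s'' ''r'' = real (Suc n) \<and> T'' \<le> (T' + (1 + bcost ?b)) + 100 * degree E (ls ! n) + 300"
        then show "?J (Suc n) T'' s'' \<and> length ls - Suc n < length ls - n"
          using 2(1) True t by simp
      qed
      moreover have "beval adj s' ?b = Some True" using 2(1) eq True by simp
      ultimately show ?thesis by auto
    next
      case False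
      then have "n = length ls" using 2 by simp
      then show ?thesis using 2(1) eq by (intro exI[of _ False]) simp
    qed
  qed
qed

end

section \<open>One phase: routing, then the search for a good level\<close>

definition level_test :: bexp where
  "level_test = And
     (Not (Less (Times (Const 5) (Var ''vo'')) (Times (Const 4) (Times (Var ''k'') (Var ''cu'')))))
     (Not (Less (Times (Const 5) (Minus (Times (Var ''p'') (Var ''vA'')) (Times (Const 8) (Var ''vo''))))
                (Times (Const 32) (Times (Var ''k'') (Var ''cu'')))))"

definition sweep_body :: com where
  "sweep_body = incr ''j'' ;; Assign ''S'' (Const 0) ;; Assign ''vo'' (Const 0) ;; Assign ''cu'' (Const 0) ;;
     Assign ''r'' (Const 0) ;; collect ;; If level_test (Assign ''ok'' (Const 1)) Skip"

definition sweep :: com where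
  "sweep = Assign ''j'' (Const 0) ;; Assign ''ok'' (Const 0) ;;
     While (Equal (Var ''ok'') (Const 0)) sweep_body ;; Assign ''go'' (Var ''cu'')"

definition phase :: com where
  "phase = Assign ''k'' (Times (Const 2) (Var ''k'')) ;;
     Assign ''h'' (Plus (Times (Times (Const 16) (Var ''k'')) (Var ''L'')) (Const 2)) ;;
     Assign ''K'' (Times (Minus (Var ''p'') (Const 8)) (Var ''k'')) ;;
     Assign ''i'' (Const 0) ;; Assign ''on'' (Const 0) ;; Assign ''x'' (Const 0) ;; Assign ''m'' (Const 0) ;;
     route ;; If (Equal (Var ''on'') (Const 0)) (Assign ''go'' (Const 0)) sweep"

text \<open>Without clock and state the equation also rewrites postconditions nested under
  \<open>wp\<close>.\<close>

lemma wp_Seq_fun: "wp adj (Seq c c') Q = wp adj c (wp adj c' Q)"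
  by (intro ext wp_Seq)

context routing begin

lemma set_filter_lst: "inv a \<Longrightarrow> 0 < j \<Longrightarrow> set (filter (\<lambda>v. j \<le> lev a v) (lst a)) = level_set a j"
  using inv_lst[of a] by (auto simp: level_set_def)

lemma sum_filter_lst:
  assumes "inv a" "0 < j"
  shows "(\<Sum>v\<leftarrow>filter (\<lambda>v. j \<le> lev a v) (lst a). f v) = (\<Sum>v\<in>level_set a j. f v)"
  using assms inv_distinct[of a] set_filter_lst[of a j]
    sum_list_distinct_conv_sum_set[of "filter (\<lambda>v. j \<le> lev a v) (lst a)" f] by simp

lemma count_low_eq:
  assumes I: "inv a" "0 < j" and v: "v \<in> V"
  shows "real (count_low (lev a) j v) = (\<Sum>u\<in>V - level_set a j. wt v u)"
proof -
  have "count_low (lev a) j v = card {u \<in> set (nbrs v). lev a u < j}"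
    using distinct_nbrs[OF v] unfolding count_low_def
    by (metis distinct_card distinct_filter set_filter)
  also have "{u \<in> set (nbrs v). lev a u < j} = {u \<in> V - level_set a j. {v, u} \<in> E}"
    using set_nbrs[OF v] edge_vertices by (auto simp: level_set_def insert_commute)
  finally show ?thesis by (simp add: sum_wt_card)
qed

lemma sum_count_low:
  assumes I: "inv a" "0 < j"
  shows "real (\<Sum>v\<in>level_set a j. count_low (lev a) j v) = cut (level_set a j) (V - level_set a j)"
  unfolding cut_def of_nat_sum
  by (intro sum.cong) (use count_low_eq[OF I] level_set_subset[OF I] in auto)

lemma collected_output:
  assumes I: "inv a" "0 < j" and C: "collected (lev a) j (filter (\<lambda>v. j \<le> lev a v) (lst a)) s"
  shows "output_set s (level_set a j)" "vars s ''vo'' = real (vol E (level_set a j))"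
    "vars s ''cu'' = cut (level_set a j) (V - level_set a j)"
proof -
  show "output_set s (level_set a j)"
    unfolding output_set_def
    by (rule exI[of _ "filter (\<lambda>v. j \<le> lev a v) (lst a)"])
       (use C inv_distinct[OF I(1)] set_filter_lst[OF I] in \<open>auto simp: collected_def\<close>)
  show "vars s ''vo'' = real (vol E (level_set a j))"
    using C sum_filter_lst[OF I, of "degree E"] by (simp add: collected_def vol_def)
  show "vars s ''cu'' = cut (level_set a j) (V - level_set a j)"
    using C sum_filter_lst[OF I, of "count_low (lev a) j"] sum_count_low[OF I]
    by (simp add: collected_def)
qed

text \<open>Listed vertices are full and nonisolated, so deg + 1 \<le> 2 deg. A pass over the list
  therefore costs O(p vol(A)), and h passes stay within the order of the time bound for the
  routing.\<close>

lemma sum_lst_le: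
  assumes I: "inv a"
  shows "4 * (\<Sum>v\<leftarrow>lst a. degree E v + 1) \<le> p * vol E (set bs)"
proof -
  have "(\<Sum>v\<leftarrow>lst a. degree E v + 1) = (\<Sum>v\<in>level_set a 1. degree E v + 1)"
  proof -
    have "filter (\<lambda>v. 1 \<le> lev a v) (lst a) = lst a"
      using inv_lst[OF I] by (intro filter_True) auto
    then show ?thesis using sum_filter_lst[OF I, of 1 "\<lambda>v. degree E v + 1"] by simp
  qed
  also have "\<dots> \<le> (\<Sum>v\<in>level_set a 1. 2 * degree E v)"
  proof (intro sum_mono)
    fix v assume "v \<in> level_set a 1"
    then have "0 < lev a v" by (simp add: level_set_def)
    then have "0 < degree E v" using inv_full[OF I, of v] by blast
    then show "degree E v + 1 \<le> 2 * degree E v" by simp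
  qed
  also have "\<dots> = 2 * vol E (level_set a 1)" by (simp add: vol_def sum_distrib_left)
  finally show ?thesis using level_set_vol_le[OF I, of 1] by linarith
qed

end

context scaled_routing begin

lemma sweep_body_correct:
  assumes I: "inv a" and s: "vars s ''j'' = real j" "vars s ''ok'' = 0" "vars s ''k'' = real k"
      "vars s ''m'' = real (length (lst a))" "\<forall>i<length (lst a). arrs s ''lst'' i = real (lst a ! i)"
      "\<forall>u. arrs s ''l'' (pcode k u) = real (lev a u)"
      "vars s ''p'' = real p" "vars s ''vA'' = real (vol E (set bs))"
  shows "wp adj sweep_body (\<lambda>T' s'. vars s' ''j'' = real (Suc j) \<and>
     vars s' ''ok'' = (if good_level a (Suc j) then 1 else 0) \<and> output_set s' (level_set a (Suc j)) \<and>
     vars s' ''cu'' = cut (level_set a (Suc j)) (V - level_set a (Suc j)) \<and>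
     T' \<le> T + 100 * (p * vol E (set bs)) + 200) T s"
proof -
  let ?pre = "incr ''j'' ;; Assign ''S'' (Const 0) ;; Assign ''vo'' (Const 0) ;; Assign ''cu'' (Const 0) ;;
     Assign ''r'' (Const 0)"
  have ls: "set (lst a) \<subseteq> V" using inv_lst[OF I] inv_full[OF I] by auto
  have body: "wp adj (collect ;; If level_test (Assign ''ok'' (Const 1)) Skip) (\<lambda>T' s'. vars s' ''j'' = real (Suc j) \<and>
     vars s' ''ok'' = (if good_level a (Suc j) then 1 else 0) \<and> output_set s' (level_set a (Suc j)) \<and>
     vars s' ''cu'' = cut (level_set a (Suc j)) (V - level_set a (Suc j)) \<and>
     T' \<le> T1 + 100 * (p * vol E (set bs)) + 100) T1 s1"
    if s1: "collected (lev a) (Suc j) [] s1" "vars s1 ''r'' = 0" "vars s1 ''j'' = real (Suc j)"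
        "vars s1 ''k'' = real k" "vars s1 ''m'' = real (length (lst a))"
        "\<forall>i<length (lst a). arrs s1 ''lst'' i = real (lst a ! i)"
        "\<forall>u. arrs s1 ''l'' (pcode k u) = real (lev a u)"
        "vars s1 ''p'' = real p" "vars s1 ''vA'' = real (vol E (set bs))" "vars s1 ''ok'' = 0" for T1 s1
    unfolding wp_Seq
  proof (rule wp_conseq[OF collect_correct[OF s1(1) ls s1(2-7)]])
    fix T2 s2
    assume Q: "collected (lev a) (Suc j) (filter (\<lambda>v. Suc j \<le> lev a v) (lst a)) s2 \<and>
      T2 \<le> T1 + 400 * (\<Sum>v\<leftarrow>lst a. degree E v + 1) + 10" and F: "frame collect s1 s2"
    have eq: "vars s2 ''j'' = real (Suc j)" "vars s2 ''k'' = real k" "vars s2 ''p'' = real p"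
        "vars s2 ''vA'' = real (vol E (set bs))" "vars s2 ''ok'' = 0"
      using F s1 by (simp_all add: frame_def collect_def collect_body_def append_vertex_def count_def count_body_def incr_def)
    note out = collected_output[OF I zero_less_Suc conjunct1[OF Q]]
    have b: "beval adj s2 level_test = Some (good_level a (Suc j))"
      using eq out(2,3) unfolding level_test_def good_level_def by (auto simp: not_less mult.assoc)
    have c: "bcost level_test \<le> 60" by (simp add: level_test_def)
    have upd: "output_set (s2\<lparr>vars := (vars s2)(''ok'' := 1)\<rparr>) (level_set a (Suc j))"
      using out(1) by (simp add: output_set_def)
    have t: "T2 \<le> T1 + 100 * (p * vol E (set bs)) + 10" using Q sum_lst_le[OF I] by linarith
    show "wp adj (If level_test (Assign ''ok'' (Const 1)) Skip) (\<lambda>T' s'. vars s' ''j'' = real (Suc j) \<and>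
     vars s' ''ok'' = (if good_level a (Suc j) then 1 else 0) \<and> output_set s' (level_set a (Suc j)) \<and>
     vars s' ''cu'' = cut (level_set a (Suc j)) (V - level_set a (Suc j)) \<and>
     T' \<le> T1 + 100 * (p * vol E (set bs)) + 100) T2 s2"
      using b c upd t out eq by (cases "good_level a (Suc j)") (simp_all add: wp_If wp_Assign wp_Skip)
  qed
  have "wp adj ?pre (\<lambda>T' s1. collected (lev a) (Suc j) [] s1 \<and> vars s1 ''r'' = 0 \<and> vars s1 ''j'' = real (Suc j) \<and>
        vars s1 ''k'' = real k \<and> vars s1 ''m'' = real (length (lst a)) \<and>
        (\<forall>i<length (lst a). arrs s1 ''lst'' i = real (lst a ! i)) \<and>
        (\<forall>u. arrs s1 ''l'' (pcode k u) = real (lev a u)) \<and>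
        vars s1 ''p'' = real p \<and> vars s1 ''vA'' = real (vol E (set bs)) \<and> vars s1 ''ok'' = 0 \<and> T' \<le> T + 50) T s"
    using s by (simp add: wp_simps incr_def collected_def)
  then have "wp adj ?pre (wp adj (collect ;; If level_test (Assign ''ok'' (Const 1)) Skip)
     (\<lambda>T' s'. vars s' ''j'' = real (Suc j) \<and>
     vars s' ''ok'' = (if good_level a (Suc j) then 1 else 0) \<and> output_set s' (level_set a (Suc j)) \<and>
     vars s' ''cu'' = cut (level_set a (Suc j)) (V - level_set a (Suc j)) \<and>
     T' \<le> T + 100 * (p * vol E (set bs)) + 200)) T s"
    by (rule wp_conseq) (rule wp_conseq[OF body], auto)
  then show ?thesis unfolding sweep_body_def by (simp only: wp_Seq_fun)
qed

text \<open>The level sets are tested upwards from level 1 until one passes.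
  \<open>ex_good_level\<close> ensures that this happens by level h, though the set found may differ
  from its witness.\<close>

lemma sweep_loop_correct:
  assumes I: "inv a" and stuck: "tok a" "lev a (pos a) = h"
    and s: "vars s ''j'' = 0" "vars s ''ok'' = 0" "vars s ''k'' = real k"
      "vars s ''m'' = real (length (lst a))" "\<forall>i<length (lst a). arrs s ''lst'' i = real (lst a ! i)"
      "\<forall>u. arrs s ''l'' (pcode k u) = real (lev a u)"
      "vars s ''p'' = real p" "vars s ''vA'' = real (vol E (set bs))"
  shows "wp adj (While (Equal (Var ''ok'') (Const 0)) sweep_body)
    (\<lambda>T' s'. (\<exists>j. 0 < j \<and> j \<le> h \<and> good_level a j \<and> output_set s' (level_set a j) \<and>
     vars s' ''cu'' = cut (level_set a j) (V - level_set a j)) \<and>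
     T' \<le> T + h * (100 * (p * vol E (set bs)) + 300) + 10) T s"
proof -
  obtain jg where jg: "0 < jg" "jg \<le> h" "good_level a jg" using ex_good_level[OF I stuck] by blast
  let ?c = "100 * (p * vol E (set bs)) + 300"
  let ?b = "Equal (Var ''ok'') (Const 0)"
  let ?J = "\<lambda>j T' s'. vars s' ''j'' = real j \<and> T' \<le> T + j * ?c \<and> j \<le> jg \<and>
    ((vars s' ''ok'' = 0 \<and> j < jg) \<or> (vars s' ''ok'' = 1 \<and> 0 < j \<and> good_level a j \<and> output_set s' (level_set a j) \<and>
     vars s' ''cu'' = cut (level_set a j) (V - level_set a j)))"
  show ?thesis
  proof (rule wp_While[where m = "\<lambda>j. jg - j" and g = "0::nat" and I = ?J], goal_cases)
    case 1
    then show ?case using s jg by simp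
  next
    case (2 j T' s')
    then have eq: "vars s' ''k'' = real k"
      "vars s' ''m'' = real (length (lst a))" "\<forall>i<length (lst a). arrs s' ''lst'' i = real (lst a ! i)"
      "\<forall>u. arrs s' ''l'' (pcode k u) = real (lev a u)"
      "vars s' ''p'' = real p" "vars s' ''vA'' = real (vol E (set bs))"
      using s by (simp_all add: frame_def sweep_body_def collect_def collect_body_def append_vertex_def
          count_def count_body_def incr_def)
    show ?case
    proof (cases "vars s' ''ok'' = 0")
      case True
      then have j: "vars s' ''j'' = real j" "j < jg" using 2(1) by auto
      have "wp adj sweep_body (\<lambda>T'' s''. \<exists>j'. ?J j' T'' s'' \<and> jg - j' < jg - j) (T' + (1 + bcost ?b)) s'"
      proof (rule wp_conseq[OF sweep_body_correct[OF I j(1) True eq]], intro exI[of _ "Suc j"])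
        fix T'' s''
        assume q: "vars s'' ''j'' = real (Suc j) \<and>
         vars s'' ''ok'' = (if good_level a (Suc j) then 1 else 0) \<and> output_set s'' (level_set a (Suc j)) \<and>
         vars s'' ''cu'' = cut (level_set a (Suc j)) (V - level_set a (Suc j)) \<and>
         T'' \<le> T' + (1 + bcost ?b) + 100 * (p * vol E (set bs)) + 200"
        have "Suc j < jg" if "\<not> good_level a (Suc j)"
          using that jg j(2) by (metis Suc_lessI)
        moreover have "T'' \<le> T + Suc j * ?c" using q 2(1) by simp
        ultimately show "?J (Suc j) T'' s'' \<and> jg - Suc j < jg - j" using q j by auto
      qed
      then show ?thesis using True by (intro exI[of _ True]) simp
    next
      case False
      then have f: "0 < j" "j \<le> h" "good_level a j" "output_set s' (level_set a j)"
        "vars s' ''cu'' = cut (level_set a j) (V - level_set a j)" "T' \<le> T + j * ?c"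
        using 2(1) jg by auto
      have "j * ?c \<le> h * ?c" using f(2) by (rule mult_le_mono1)
      moreover have "1 + bcost ?b \<le> 10" by simp
      ultimately have "T' + (1 + bcost ?b) \<le> T + h * ?c + 10" using f(6) by linarith
      with f False show ?thesis by (intro exI[of _ False]) auto
    qed
  qed
qed

text \<open>Isolated vertices are not in \<open>bs\<close>, so each source has degree at least 1,
  and moving through the sources fits into the time of the routing.\<close>

lemma bs_length_le: "length bs \<le> p * vol E (set bs)"
proof -
  have "length bs = card (set bs)" using bs(1) by (simp add: distinct_card)
  also have "\<dots> = (\<Sum>v\<in>set bs. 1)" by simp
  also have "\<dots> \<le> vol E (set bs)" unfolding vol_def using bs(3) by (intro sum_mono) fastforce
  also have "\<dots> \<le> p * vol E (set bs)" using p_ge by simp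
  finally show ?thesis .
qed

text \<open>After a successful routing the output cells are untouched: the set of the previous phase
  remains the answer. After a failure \<open>go\<close> receives the number of cut edges, so the
  search also ends when the boundary is empty, the conductance then being 0.\<close>

definition phase_result :: "state \<Rightarrow> state \<Rightarrow> bool" where
  "phase_result s s' \<longleftrightarrow>
     (vars s' ''go'' = 0 \<and> vars s' ''S'' = vars s ''S'' \<and> arrs s' ''S'' = arrs s ''S'' \<and>
      (\<forall>X\<subseteq>V. real p * vol E (set bs \<inter> X) \<le> 8 * real (vol E X) + real K * cut X (V - X))) \<or>
     (\<exists>X\<subseteq>V. output_set s' X \<and> 0 < vol E X \<and> 8 * vol E X < p * vol E (set bs) \<and>
       4 * k * cut X (V - X) \<le> 5 * vol E X \<and>
       32 * k * cut X (V - X) \<le> 5 * (real p * vol E (set bs) - 8 * real (vol E X)) \<and>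
       vars s' ''go'' = cut X (V - X))"

lemma phase_correct:
  assumes s: "vars s ''k'' = real k0" "k = 2 * k0" "vars s ''p'' = real p" "vars s ''L'' = real L"
      "vars s ''nb'' = real (length bs)" "vars s ''vA'' = real (vol E (set bs))"
      "\<forall>i<length bs. arrs s ''B'' i = real (bs ! i)" and Z: "zeroed k s"
  shows "wp adj phase (\<lambda>T' s'. zeroed (Suc k) s' \<and> vars s' ''k'' = real k \<and>
    T' \<le> T + 10000 * (h * (p * vol E (set bs) + 1)) \<and> phase_result s s') T s"
proof -
  let ?P = "p * vol E (set bs)"
  let ?Q = "\<lambda>T' s'. zeroed (Suc k) s' \<and> vars s' ''k'' = real k \<and>
    T' \<le> T + 10000 * (h * (?P + 1)) \<and> phase_result s s'"
  let ?pre = "Assign ''k'' (Times (Const 2) (Var ''k'')) ;;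
     Assign ''h'' (Plus (Times (Times (Const 16) (Var ''k'')) (Var ''L'')) (Const 2)) ;;
     Assign ''K'' (Times (Minus (Var ''p'') (Const 8)) (Var ''k'')) ;;
     Assign ''i'' (Const 0) ;; Assign ''on'' (Const 0) ;; Assign ''x'' (Const 0) ;; Assign ''m'' (Const 0)"
  let ?post = "If (Equal (Var ''on'') (Const 0)) (Assign ''go'' (Const 0)) sweep"
  have zero: "arrs s ''l'' (pcode k v) = 0" "arrs s ''cur'' (pcode k v) = 0" "arrs s ''ab'' (pcode k v) = 0"
      "arrs s ''inj'' (pcode k v) = 0" "arrs s ''g'' (pcode k v) = 0" for v
    using Z by (simp_all add: zeroed_def)
  have Z': "zeroed (Suc k) s" using Z by (simp add: zeroed_def)
  have hK: "real h = 16 * real k * real L + 2" "real K = (real p - 8) * real k"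
    using h_eq K_eq p_ge by (simp_all add: of_nat_diff)
  have 1: "wp adj ?pre (\<lambda>T' s'. repr k s' empty_routing \<and> params k s' \<and> zeroed (Suc k) s' \<and>
      vars s' ''vA'' = real (vol E (set bs)) \<and> vars s' ''S'' = vars s ''S'' \<and> arrs s' ''S'' = arrs s ''S'' \<and>
      T' \<le> T + 100) T s"
    using s hK zero Z' by (simp add: wp_simps repr_def params_def empty_routing_def zeroed_def)
  have 2: "wp adj route (wp adj ?post ?Q) T1 s1"
    if a: "repr k s1 empty_routing" "params k s1" "zeroed (Suc k) s1" "vars s1 ''vA'' = real (vol E (set bs))"
      "vars s1 ''S'' = vars s ''S''" "arrs s1 ''S'' = arrs s ''S''" "T1 \<le> T + 100" for T1 s1
  proof (rule wp_conseq[OF route_correct[OF a(1-3)]], elim exE conjE)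
    fix T2 s2 a
    assume F: "frame route s1 s2" and R: "repr k s2 a" "inv a" "\<not> running a" "params k s2" "zeroed (Suc k) s2"
      and T2: "int T2 \<le> int T1 + 600 * (6 * int h * int ?P + int (length bs) + int h + 1)"
    have S: "vars s2 ''S'' = vars s ''S''" "arrs s2 ''S'' = arrs s ''S''" "vars s2 ''vA'' = real (vol E (set bs))"
      using F that by (simp_all add: frame_def route_def route_body_def set_cell_def incr_def)
    have h1: "1 \<le> h" by (simp add: h_eq)
    have "int (length bs) \<le> int ?P" using bs_length_le by (intro of_nat_mono)
    moreover have h2: "1 \<le> int h" using h1 by simp
    moreover have "1 * int ?P \<le> int h * int ?P" using h2 by (rule mult_right_mono) simp
    moreover have "int T1 \<le> int T + 100" using \<open>T1 \<le> T + 100\<close> by simp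
    \<comment> \<open>The only fact about the product is Q \<le> H Q; the rest is linear.\<close>
    moreover have "t2 \<le> t + (4200 * (H * Q) + 1300 * H)"
      if "n \<le> Q" "1 \<le> H" "1 * Q \<le> H * Q" "t1 \<le> t + 100" "t2 \<le> t1 + 600 * (6 * H * Q + n + H + 1)"
      for t t1 t2 n H Q :: int
      using that by (simp add: algebra_simps)
    ultimately have "int T2 \<le> int T + (4200 * (int h * int ?P) + 1300 * int h)"
      using T2 by blast
    then have "int T2 \<le> int (T + (4200 * (h * ?P) + 1300 * h))" by simp
    then have t: "T2 \<le> T + (4200 * (h * ?P) + 1300 * h)" by (simp only: of_nat_le_iff)
    show "wp adj ?post ?Q T2 s2"
    proof (cases "tok a")
      case False
      then have "src a = length bs"
        using R(3) inv_no_tok[OF R(2)] h_pos inv_src_le[OF R(2)] by (auto simp: running_def)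
      with False have "phase_result s (s2\<lparr>vars := (vars s2)(''go'' := 0)\<rparr>)"
        using routed_cut_bound[OF R(2)] S unfolding phase_result_def by simp
      moreover have "vars s2 ''on'' = 0" "vars s2 ''k'' = real k" using R(1,4) False by (simp_all add: repr_def params_def)
      moreover have "T2 + 10 \<le> T + 10000 * (h * (?P + 1))" using t h1 by (simp add: algebra_simps)
      ultimately show ?thesis using R(5) by (simp add: wp_If wp_Assign zeroed_def)
    next
      case True
      then have stuck: "lev a (pos a) = h"
        using R(3) inv_lev_le[OF R(2), of "pos a"] by (simp add: running_def)
      have sw: "wp adj (Assign ''j'' (Const 0) ;; Assign ''ok'' (Const 0)) (\<lambda>T' s'. vars s' ''j'' = 0 \<and> vars s' ''ok'' = 0 \<and>
         vars s' ''k'' = real k \<and> vars s' ''m'' = real (length (lst a)) \<and>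
         (\<forall>i<length (lst a). arrs s' ''lst'' i = real (lst a ! i)) \<and>
         (\<forall>u. arrs s' ''l'' (pcode k u) = real (lev a u)) \<and>
         vars s' ''p'' = real p \<and> vars s' ''vA'' = real (vol E (set bs)) \<and> zeroed (Suc k) s' \<and> T' \<le> T2 + 20) (T2 + (1 + bcost (Equal (Var ''on'') (Const 0)))) s2"
        using R S by (simp add: wp_simps repr_def params_def zeroed_def)
      have lp: "wp adj (While (Equal (Var ''ok'') (Const 0)) sweep_body) (wp adj (Assign ''go'' (Var ''cu'')) ?Q) T3 s3"
        if b: "vars s3 ''j'' = 0" "vars s3 ''ok'' = 0" "vars s3 ''k'' = real k" "vars s3 ''m'' = real (length (lst a))"
         "\<forall>i<length (lst a). arrs s3 ''lst'' i = real (lst a ! i)"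
         "\<forall>u. arrs s3 ''l'' (pcode k u) = real (lev a u)"
         "vars s3 ''p'' = real p" "vars s3 ''vA'' = real (vol E (set bs))" "zeroed (Suc k) s3" "T3 \<le> T2 + 20" for T3 s3
      proof (rule wp_conseq[OF sweep_loop_correct[OF R(2) True stuck b(1-8)]], elim exE conjE)
        fix T4 s4 j
        assume F: "frame (While (Equal (Var ''ok'') (Const 0)) sweep_body) s3 s4"
          and j: "0 < j" "j \<le> h" "good_level a j" "output_set s4 (level_set a j)"
            "vars s4 ''cu'' = cut (level_set a j) (V - level_set a j)"
          and T4: "T4 \<le> T3 + h * (100 * ?P + 300) + 10"
        let ?X = "level_set a j"
        have eq: "vars s4 ''k'' = real k" "zeroed (Suc k) s4"
          using F b(3,9) by (simp_all add: frame_def sweep_body_def collect_def collect_body_def append_vertex_def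
            count_def count_body_def incr_def zeroed_def)
        have "vol E {pos a} \<le> vol E ?X"
          using vol_mono finite_subset_V[OF level_set_subset[OF R(2) j(1)]] stuck j(2) by (simp add: level_set_def)
        then have "0 < vol E ?X" using inv_tok[OF R(2) True] by (simp add: vol_def)
        moreover have "8 * vol E ?X < ?P" using level_set_vol_le[OF R(2) j(1)] True by simp
        moreover have "output_set (s4\<lparr>vars := (vars s4)(''go'' := cut ?X (V - ?X))\<rparr>) ?X"
          using j(4) by (simp add: output_set_def)
        ultimately have "phase_result s (s4\<lparr>vars := (vars s4)(''go'' := cut ?X (V - ?X))\<rparr>)"
          unfolding phase_result_def using level_set_subset[OF R(2) j(1)] j(3)
          by (intro disjI2 exI[of _ ?X]) (simp add: good_level_def)
        moreover have "T4 + 2 \<le> T + 10000 * (h * (?P + 1))"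
          using t T4 b(10) h1 by (simp add: algebra_simps)
        ultimately show "wp adj (Assign ''go'' (Var ''cu'')) ?Q T4 s4"
          using eq j(5) by (simp add: wp_Assign zeroed_def)
      qed
      have "wp adj (Assign ''j'' (Const 0) ;; Assign ''ok'' (Const 0)) (wp adj (While (Equal (Var ''ok'') (Const 0)) sweep_body)
          (wp adj (Assign ''go'' (Var ''cu'')) ?Q)) (T2 + (1 + bcost (Equal (Var ''on'') (Const 0)))) s2"
        by (rule wp_conseq[OF sw]) (blast intro: lp)
      moreover have "vars s2 ''on'' = 1" using R(1) True by (simp add: repr_def)
      ultimately show ?thesis by (simp add: wp_If sweep_def wp_Seq_fun)
    qed
  qed
  have "wp adj ?pre (wp adj route (wp adj ?post ?Q)) T s"
    by (rule wp_conseq[OF 1]) (blast intro: 2)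
  then show ?thesis unfolding phase_def by (simp only: wp_Seq_fun)
qed

end


section \<open>The search for k\<close>

locale improve = local_graph +
  fixes bs :: "nat list" and p L :: nat
  assumes bs_set: "distinct bs" "set bs \<subseteq> V" "\<And>v. v \<in> set bs \<Longrightarrow> 0 < degree E v"
    and p_ge_16: "16 \<le> p" and L_large: "p * vol E (set bs) \<le> 2 ^ L"
    and p_small: "p * vol E (set bs) \<le> 8 * vol E V"
begin

lemma scaled_routing: "0 < k \<Longrightarrow> scaled_routing V E adj bs p ((p - 8) * k) (16 * k * L + 2) k L"
  by unfold_locales (use bs_set p_ge_16 L_large in auto)

definition ready :: "state \<Rightarrow> bool" where
  "ready s \<longleftrightarrow> vars s ''p'' = real p \<and> vars s ''L'' = real L \<and> vars s ''nb'' = real (length bs) \<and>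
     vars s ''vA'' = real (vol E (set bs)) \<and> (\<forall>i<length bs. arrs s ''B'' i = real (bs ! i))"

definition certified :: "nat \<Rightarrow> bool" where
  "certified k \<longleftrightarrow> (\<forall>X\<subseteq>V. real p * vol E (set bs \<inter> X) \<le> 8 * real (vol E X) + (real p - 8) * k * cut X (V - X))"

text \<open>While \<open>go\<close> is positive, the stored set was found at k. After a success it
  stems from k / 2, which turns 5/(4k) into 5/(2k). The exception k = 1 is the input set, the first
  candidate, whose conductance may be 0.\<close>

definition main_inv :: "nat \<Rightarrow> state \<Rightarrow> bool" where
  "main_inv k s \<longleftrightarrow> ready s \<and> vars s ''k'' = real k \<and> 0 < k \<and> zeroed (Suc k) s \<and>
     (\<exists>S\<subseteq>V. output_set s S \<and> 0 < vol E S \<and> 0 < vol E (V - S) \<and> 8 * vol E S \<le> p * vol E (set bs) \<and>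
       (if 0 < vars s ''go'' then conductance V E S \<le> 5 / (4 * k) \<and> (k = 1 \<or> 0 < conductance V E S)
        else conductance V E S = 0 \<or> (conductance V E S \<le> 5 / (2 * k) \<and> certified k)))"

lemma vol_Diff: "S \<subseteq> V \<Longrightarrow> vol E V = vol E S + vol E (V - S)"
  using vol_Int_Diff[OF finite_V, of S] by (simp add: Int_absorb1)

lemma conductance_le:
  assumes S: "S \<subseteq> V" "0 < vol E S" "0 < vol E (V - S)" and k: "0 < k"
    and t: "4 * real k * cut S (V - S) \<le> 5 * vol E S" "4 * real k * cut S (V - S) \<le> 5 * vol E (V - S)"
  shows "conductance V E S \<le> 5 / (4 * k)"
proof -
  have "4 * real k * cut S (V - S) \<le> 5 * min (real (vol E S)) (real (vol E (V - S)))"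
    using t by (simp add: min_def)
  moreover have "0 < min (real (vol E S)) (real (vol E (V - S)))" using S by simp
  ultimately show ?thesis using k unfolding conductance_cut[OF S(1)]
    by (simp add: divide_le_eq le_divide_eq mult.commute mult.left_commute del: min_less_iff_conj)
qed

text \<open>A nonempty cut has at least one edge. Together with a conductance of at most 5/(4k),
  this bounds k by the volume and stops the doubling.\<close>

lemma conductance_ge:
  assumes S: "S \<subseteq> V" "0 < conductance V E S"
  shows "1 / real (vol E S) \<le> conductance V E S"
proof -
  let ?m = "min (vol E S) (vol E (V - S))"
  have "0 < ?m" "0 < card (edges_between E S (V - S))"
    using S(2) unfolding conductance_def by (auto simp: zero_less_divide_iff intro: Nat.gr0I)
  then have "1 \<le> real (card (edges_between E S (V - S)))" "0 < real ?m" "real ?m \<le> real (vol E S)"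
    by (simp_all del: of_nat_min)
  then show ?thesis unfolding conductance_def by (intro frac_le) auto
qed

lemma main_step:
  assumes I: "main_inv k0 s" and go: "0 < vars s ''go''"
  shows "wp adj phase (\<lambda>T' s'. main_inv (2 * k0) s' \<and>
     T' \<le> T + 10000 * ((16 * (2 * k0) * L + 2) * (p * vol E (set bs) + 1))) T s"
    and "k0 \<le> 2 * (p * vol E (set bs))"
proof -
  let ?k = "2 * k0" let ?P = "p * vol E (set bs)"
  have k0: "0 < k0" using I by (simp add: main_inv_def)
  interpret R: scaled_routing V E adj bs p "(p - 8) * ?k" "16 * ?k * L + 2" ?k L
    by (rule scaled_routing) (use k0 in simp)
  obtain S where S: "S \<subseteq> V" "output_set s S" "0 < vol E S" "0 < vol E (V - S)" "8 * vol E S \<le> ?P"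
      "conductance V E S \<le> 5 / (4 * k0)" "k0 = 1 \<or> 0 < conductance V E S"
    using I go unfolding main_inv_def by auto
  show "k0 \<le> 2 * ?P"
  proof (cases "k0 = 1")
    case True
    have "0 < ?P" using S(3,5) by linarith
    with True show ?thesis by linarith
  next
    case False
    then have "1 / real (vol E S) \<le> conductance V E S" using conductance_ge S by blast
    then have "1 / real (vol E S) \<le> 5 / (4 * k0)" using S(6) by simp
    then have "4 * real k0 \<le> 5 * vol E S" using S(3) k0 by (simp add: field_simps)
    then have "4 * k0 \<le> 5 * vol E S" by linarith
    then show ?thesis using S(5) by linarith
  qed
  have Z: "zeroed ?k s" using I k0 unfolding main_inv_def zeroed_def by auto
  have s: "vars s ''k'' = real k0" "?k = 2 * k0" "vars s ''p'' = real p" "vars s ''L'' = real L"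
      "vars s ''nb'' = real (length bs)" "vars s ''vA'' = real (vol E (set bs))"
      "\<forall>i<length bs. arrs s ''B'' i = real (bs ! i)"
    using I unfolding main_inv_def ready_def by auto
  show "wp adj phase (\<lambda>T' s'. main_inv (2 * k0) s' \<and>
     T' \<le> T + 10000 * ((16 * ?k * L + 2) * (?P + 1))) T s"
  proof (rule wp_conseq[OF R.phase_correct[OF s Z]], elim conjE, intro conjI)
    fix T' s'
    assume F: "frame phase s s'" and z: "zeroed (Suc ?k) s'" "vars s' ''k'' = real ?k" and res: "R.phase_result s s'"
    have eq: "vars s' ''p'' = vars s ''p''" "vars s' ''L'' = vars s ''L''" "vars s' ''nb'' = vars s ''nb''"
        "vars s' ''vA'' = vars s ''vA''" "arrs s' ''B'' = arrs s ''B''"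
      using F by (simp_all add: frame_def phase_def route_def route_body_def set_cell_def sweep_def sweep_body_def
          collect_def collect_body_def append_vertex_def count_def count_body_def incr_def)
    have ready: "ready s'" unfolding ready_def eq using s by simp
    have K: "real ((p - 8) * ?k) = (real p - 8) * ?k" using p_ge_16 by (simp add: of_nat_diff)
    from res show "main_inv ?k s'"
      unfolding R.phase_result_def
    proof (elim disjE conjE exE)
      assume a: "vars s' ''go'' = 0" "vars s' ''S'' = vars s ''S''" "arrs s' ''S'' = arrs s ''S''"
        "\<forall>X\<subseteq>V. real p * vol E (set bs \<inter> X) \<le> 8 * real (vol E X) + real ((p - 8) * ?k) * cut X (V - X)"
      have "certified ?k" unfolding certified_def using a(4) unfolding K .
      moreover have "output_set s' S" using S(2) a(2,3) unfolding output_set_def by simp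
      moreover have "conductance V E S \<le> 5 / (2 * ?k)" using S(6) by simp
      ultimately show ?thesis
        unfolding main_inv_def using ready z k0 a(1) S by (intro conjI exI[of _ S]) auto
    next
      fix X
      assume X: "X \<subseteq> V" "output_set s' X" "0 < vol E X" "8 * vol E X < ?P"
        and t: "4 * ?k * cut X (V - X) \<le> 5 * vol E X"
          "32 * ?k * cut X (V - X) \<le> 5 * (real p * vol E (set bs) - 8 * real (vol E X))"
        and g: "vars s' ''go'' = cut X (V - X)"
      \<comment> \<open>The bound on vol(X) is strict because of the stuck unit, so the complement
        has positive volume.\<close>
      have v: "0 < vol E (V - X)" using X(4) p_small vol_Diff[OF X(1)] by linarith
      have "real ?P \<le> real (8 * vol E V)" using p_small by (rule of_nat_mono)
      then have "real p * vol E (set bs) - 8 * real (vol E X) \<le> 8 * real (vol E (V - X))"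
        using vol_Diff[OF X(1)] by simp
      then have "4 * real ?k * cut X (V - X) \<le> 5 * vol E (V - X)" using t(2) by simp
      then have c: "conductance V E X \<le> 5 / (4 * ?k)"
        using conductance_le[OF X(1,3) v, of ?k] t(1) k0 by simp
      have "0 < conductance V E X \<longleftrightarrow> 0 < cut X (V - X)"
        unfolding conductance_cut[OF X(1)] using X(3) v cut_nonneg[of X "V - X"] by (auto simp: zero_less_divide_iff)
      moreover have "conductance V E X = 0 \<longleftrightarrow> cut X (V - X) = 0"
        unfolding conductance_cut[OF X(1)] using X(3) v by (simp add: min_def)
      ultimately show ?thesis
        unfolding main_inv_def using ready z k0 X v c g cut_nonneg[of X "V - X"]
        by (intro conjI exI[of _ X]) auto
    qed
  qed
qed

text \<open>The costs of the phases form a geometric series: the phase for 2k costs no more than the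
  increase of the budget from k to 2k. Before a doubling k is at most 2 p vol(A), so k never exceeds
  \<open>4 * ?P\<close> and the measure decreases.\<close>

lemma main_loop_correct:
  assumes I: "main_inv 1 s"
  shows "wp adj (While (Less (Const 0) (Var ''go'')) phase)
    (\<lambda>T' s'. \<exists>k. main_inv k s' \<and> \<not> 0 < vars s' ''go'' \<and>
      T' \<le> T + 800000 * (k * ((L + 1) * (p * vol E (set bs) + 1))) + 10) T s"
proof -
  let ?P = "p * vol E (set bs)"
  let ?Z = "(L + 1) * (?P + 1)"
  let ?b = "Less (Const 0) (Var ''go'')"
  let ?J = "\<lambda>k T' s'. main_inv k s' \<and> T' \<le> T + 800000 * (k * ?Z)"
  show ?thesis
  proof (rule wp_While[where I = ?J and g = "1::nat" and m = "\<lambda>k. 4 * ?P - k"], goal_cases)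
    case 1
    then show ?case using I by simp
  next
    case (2 k T' s')
    then have J: "main_inv k s'" "T' \<le> T + 800000 * (k * ?Z)" by auto
    have k: "0 < k" using J(1) by (simp add: main_inv_def)
    show ?case
    proof (cases "0 < vars s' ''go''")
      case True
      have kP: "k \<le> 2 * ?P" using main_step(2)[OF J(1) True] .
      have "wp adj phase (\<lambda>T'' s''. \<exists>k'. ?J k' T'' s'' \<and> 4 * ?P - k' < 4 * ?P - k) (T' + (1 + bcost ?b)) s'"
      proof (rule wp_conseq[OF main_step(1)[OF J(1) True]], intro exI[of _ "2 * k"], elim conjE)
        fix T'' s''
        assume m: "main_inv (2 * k) s''"
          and t: "T'' \<le> T' + (1 + bcost ?b) + 10000 * ((16 * (2 * k) * L + 2) * (?P + 1))"
        have "(16 * (2 * k) * L + 2) * (?P + 1) \<le> (34 * (k * (L + 1))) * (?P + 1)"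
          using k by (intro mult_le_mono1) (simp add: algebra_simps)
        also have "\<dots> = 34 * (k * ?Z)" by (simp only: mult.assoc)
        finally have "(16 * (2 * k) * L + 2) * (?P + 1) \<le> 34 * (k * ?Z)" .
        moreover have "1 * 1 \<le> k * ?Z" using k by (intro mult_le_mono) auto
        moreover have "1 + bcost ?b \<le> 10" by simp
        ultimately have "T'' \<le> T + 800000 * (2 * (k * ?Z))" using t J(2) by linarith
        then have "T'' \<le> T + 800000 * (2 * k * ?Z)" by (simp only: mult.assoc)
        with m kP k show "?J (2 * k) T'' s'' \<and> 4 * ?P - 2 * k < 4 * ?P - k" by simp
      qed
      then show ?thesis using True by (intro exI[of _ True]) simp
    next
      case False
      have "T' + (1 + bcost ?b) \<le> T + 800000 * (k * ?Z) + 10" using J(2) by simp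
      then show ?thesis using J(1) False by (intro exI[of _ False]) auto
    qed
  qed
qed

end

section \<open>Reading the input and choosing p and L\<close>

definition read_body :: com where
  "read_body = Store ''S'' (Var ''i'') (Elem ''A'' (Var ''i'')) ;;
     If (Less (Const 0) (Deg (Elem ''A'' (Var ''i''))))
       (Store ''B'' (Var ''nb'') (Elem ''A'' (Var ''i'')) ;; incr ''nb'' ;;
        Assign ''vA'' (Plus (Var ''vA'') (Deg (Elem ''A'' (Var ''i''))))) Skip ;;
     incr ''i''"

definition read_input :: com where
  "read_input = While (Less (Var ''i'') (Var ''A'')) read_body"

text \<open>There is no rounding operation, so p is counted up from 16 until p + 1 would violate (p
  + 1 + 16) \<sigma> \<le> 24; this takes O(1/\<sigma>) steps.\<close>

definition find_p :: com where
  "find_p = While (Not (Less (Const 24) (Times (Plus (Var ''p'') (Const 17)) (Var ''sigma'')))) (incr ''p'')"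

definition find_L_body :: com where
  "find_L_body = Assign ''w'' (Times (Const 2) (Var ''w'')) ;; incr ''L''"

definition find_L :: com where
  "find_L = While (Less (Var ''w'') (Times (Var ''p'') (Var ''vA''))) find_L_body"

text \<open>The first phase runs with k = 2. For k = 1 the input set, already copied to
  \<open>S\<close>, acts as the set found, since its conductance is at most 1 \<le> 5/4.\<close>

definition local_improve :: com where
  "local_improve = read_input ;; (Assign ''S'' (Var ''A'') ;; Assign ''p'' (Const 16)) ;; find_p ;;
     Assign ''w'' (Const 1) ;; find_L ;; (Assign ''k'' (Const 1) ;; Assign ''go'' (Const 1)) ;;
     While (Less (Const 0) (Var ''go'')) phase"

context local_graph begin

lemma read_input_correct:
  assumes as: "set as \<subseteq> V"
    and s: "vars s ''i'' = 0" "vars s ''nb'' = 0" "vars s ''vA'' = 0" "vars s ''A'' = real (length as)"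
      "\<forall>i<length as. arrs s ''A'' i = real (as ! i)"
  defines "bs \<equiv> filter (\<lambda>v. 0 < degree E v) as"
  shows "wp adj read_input (\<lambda>T' s'. vars s' ''nb'' = real (length bs) \<and>
     (\<forall>i<length bs. arrs s' ''B'' i = real (bs ! i)) \<and> vars s' ''vA'' = real (\<Sum>v\<leftarrow>bs. degree E v) \<and>
     (\<forall>i<length as. arrs s' ''S'' i = real (as ! i)) \<and> T' \<le> T + 100 * length as + 10) T s"
proof -
  let ?f = "\<lambda>n. filter (\<lambda>v. 0 < degree E v) (take n as)"
  let ?J = "\<lambda>n T' s'. n \<le> length as \<and> vars s' ''i'' = real n \<and> vars s' ''nb'' = real (length (?f n)) \<and>
     (\<forall>i<length (?f n). arrs s' ''B'' i = real (?f n ! i)) \<and> vars s' ''vA'' = real (\<Sum>v\<leftarrow>?f n. degree E v) \<and>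
     (\<forall>i<n. arrs s' ''S'' i = real (as ! i)) \<and> T' \<le> T + 100 * n"
  let ?b = "Less (Var ''i'') (Var ''A'')"
  show ?thesis
    unfolding read_input_def
  proof (rule wp_While[where m = "\<lambda>n. length as - n" and g = "0::nat" and I = ?J], goal_cases)
    case 1
    then show ?case using s by simp
  next
    case (2 n T' s')
    then have eq: "vars s' ''A'' = real (length as)" "\<forall>i<length as. arrs s' ''A'' i = real (as ! i)"
      using s by (simp_all add: frame_def read_body_def incr_def)
    show ?case
    proof (cases "n < length as")
      case True
      have v: "as ! n \<in> V" using True as by auto
      have t: "?f (Suc n) = ?f n @ (if 0 < degree E (as ! n) then [as ! n] else [])"
        using True by (simp add: take_Suc_conv_app_nth)
      have "wp adj read_body (?J (Suc n)) (T' + (1 + bcost ?b)) s'"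
        unfolding t using 2(1) eq True v
        by (cases "0 < degree E (as ! n)")
          (simp_all add: read_body_def wp_simps incr_def adj_eq length_nbrs nth_append less_Suc_eq)
      then have "wp adj read_body (\<lambda>T'' s''. \<exists>n'. ?J n' T'' s'' \<and> length as - n' < length as - n)
          (T' + (1 + bcost ?b)) s'"
        by (rule wp_conseq) (use True in \<open>blast intro: diff_less_mono2[OF lessI]\<close>)
      then show ?thesis using 2(1) eq True by (intro exI[of _ True]) simp
    next
      case False
      then have "n = length as" using 2(1) by simp
      then show ?thesis using 2(1) eq unfolding bs_def by (intro exI[of _ False]) simp
    qed
  qed
qed

lemma find_p_correct:
  assumes s: "vars s ''p'' = 16" "vars s ''sigma'' = \<sigma>" and \<sigma>: "0 < \<sigma>" "\<sigma> \<le> 1"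
  shows "wp adj find_p (\<lambda>T' s'. \<exists>p. vars s' ''p'' = real p \<and> 16 \<le> p \<and> 24 < (real p + 17) * \<sigma> \<and>
     (p = 16 \<or> (real p + 16) * \<sigma> \<le> 24) \<and> T' \<le> T + 50 * p) T s"
proof -
  let ?J = "\<lambda>p T' s'. vars s' ''p'' = real p \<and> 16 \<le> p \<and> (p = 16 \<or> (real p + 16) * \<sigma> \<le> 24) \<and> T' + 20 \<le> T + 50 * p"
  let ?b = "Not (Less (Const 24) (Times (Plus (Var ''p'') (Const 17)) (Var ''sigma'')))"
  show ?thesis
    unfolding find_p_def
  proof (rule wp_While[where m = "\<lambda>n. nat \<lceil>24 / \<sigma>\<rceil> - n" and g = "16::nat" and I = ?J], goal_cases)
    case 1
    then show ?case using s by simp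
  next
    case (2 p T' s')
    then have eq: "vars s' ''sigma'' = \<sigma>" using s by (simp add: frame_def incr_def)
    have c: "1 + bcost ?b \<le> 20" by simp
    show ?case
    proof (cases "24 < (real p + 17) * \<sigma>")
      case True
      then show ?thesis using 2(1) eq by (intro exI[of _ False]) auto
    next
      case False
      then have "real p + 17 \<le> 24 / \<sigma>" using \<sigma> by (simp add: le_divide_eq)
      then have "p < nat \<lceil>24 / \<sigma>\<rceil>" by linarith
      moreover have "(real (Suc p) + 16) * \<sigma> \<le> 24" using False by (simp add: algebra_simps)
      ultimately have "wp adj (incr ''p'') (\<lambda>T'' s''. \<exists>p'. ?J p' T'' s'' \<and> nat \<lceil>24 / \<sigma>\<rceil> - p' < nat \<lceil>24 / \<sigma>\<rceil> - p)
          (T' + (1 + bcost ?b)) s'"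
        using 2(1) c by (simp add: wp_Assign incr_def) (intro exI[of _ "Suc p"], simp)
      then show ?thesis using False eq 2(1) by (intro exI[of _ True]) simp
    qed
  qed
qed

lemma find_L_correct:
  assumes s: "vars s ''w'' = 1" "vars s ''L'' = 0" "vars s ''p'' = real p" "vars s ''vA'' = real v"
  shows "wp adj find_L (\<lambda>T' s'. \<exists>L. vars s' ''L'' = real L \<and> p * v \<le> 2 ^ L \<and> (L = 0 \<or> 2 ^ (L - 1) < p * v) \<and>
     T' \<le> T + 50 * L + 20) T s"
proof -
  let ?J = "\<lambda>L T' s'. vars s' ''L'' = real L \<and> vars s' ''w'' = real (2 ^ L) \<and> (L = 0 \<or> 2 ^ (L - 1) < p * v) \<and> T' \<le> T + 50 * L"
  let ?b = "Less (Var ''w'') (Times (Var ''p'') (Var ''vA''))"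
  show ?thesis
    unfolding find_L_def
  proof (rule wp_While[where m = "\<lambda>L. p * v - L" and g = "0::nat" and I = ?J], goal_cases)
    case 1
    then show ?case using s by simp
  next
    case (2 L T' s')
    then have eq: "vars s' ''p'' = real p" "vars s' ''vA'' = real v"
      using s by (simp_all add: frame_def find_L_body_def incr_def)
    have c: "real (2 ^ L) < real p * real v \<longleftrightarrow> 2 ^ L < p * v" by (metis of_nat_less_iff of_nat_mult)
    have b: "beval adj s' ?b = Some (2 ^ L < p * v)" using 2(1) eq c by simp
    show ?case
    proof (cases "2 ^ L < p * v")
      case True
      have "L < p * v" using True less_exp[of L] by linarith
      have "wp adj find_L_body (?J (Suc L)) (T' + (1 + bcost ?b)) s'"
        using 2(1) True by (simp add: find_L_body_def wp_simps incr_def)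
      then have "wp adj find_L_body (\<lambda>T'' s''. \<exists>L'. ?J L' T'' s'' \<and> p * v - L' < p * v - L) (T' + (1 + bcost ?b)) s'"
        by (rule wp_conseq) (use \<open>L < p * v\<close> in \<open>blast intro: diff_less_mono2[OF lessI]\<close>)
      then show ?thesis using b True by (intro exI[of _ True]) simp
    next
      case False
      then show ?thesis using b 2(1) by (intro exI[of _ False]) auto
    qed
  qed
qed

end


section \<open>The theorem\<close>

lemma time_bound:
  fixes \<sigma> \<phi> :: real and t n m p L k v :: nat
  assumes \<sigma>: "0 < \<sigma>" "\<sigma> \<le> 1" and v: "0 < v" and p: "real p * \<sigma> \<le> 24"
    and L: "L = 0 \<or> 2 ^ (L - 1) < p * v" and \<phi>: "0 < \<phi>" "\<phi> \<le> 1" "\<phi> \<le> 5 / (2 * k)" and k: "0 < k"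
    and n: "n \<le> v + m"
    and t: "t \<le> 100 * n + 50 * p + 50 * L + 800000 * (k * ((L + 1) * (p * v + 1))) + 300"
  shows "real t \<le> 500000000 * (real v / (\<sigma> * \<phi>) * (log_factor (real v / \<sigma>))\<^sup>2 + real m)"
proof -
  define X where "X = real v / \<sigma>"
  define f where "f = log_factor X"
  define Y where "Y = X / \<phi> * f\<^sup>2"
  have "real v * \<sigma> \<le> real v * 1" using \<sigma> by (intro mult_left_mono) auto
  then have vX: "real v \<le> X" using \<sigma> by (simp add: X_def le_divide_eq)
  have X1: "1 \<le> X" using vX v by linarith
  have f1: "1 \<le> f" "ln X \<le> f" by (simp_all add: f_def log_factor_def)
  have p24: "real p \<le> 24 / \<sigma>" using p \<sigma> by (simp add: le_divide_eq)
  have pv: "real (p * v) \<le> 24 * X"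
    using mult_right_mono[OF p24, of "real v"] by (simp add: X_def)
  have "1 / \<sigma> \<le> X" using v \<sigma> unfolding X_def by (intro divide_right_mono) auto
  then have pX: "real p \<le> 24 * X" using p24 by simp
  \<comment> \<open>For large L, 2^(L - 1) < p v \<le> 32 X gives 2^(L - 6) < X; with ln 2 \<ge> 1/2
    this means L \<le> 6 + 2 f, and f \<ge> 1 absorbs the constants.\<close>
  have Lf: "real L + 1 \<le> 9 * f"
  proof (cases "L \<le> 6")
    case True
    then have "real L \<le> 6" by simp
    then show ?thesis using f1 by linarith
  next
    case False
    then have "2 ^ (L - 1) < p * v" using L by simp
    then have "real (2 ^ (L - 1)) < real (p * v)" by (rule of_nat_less_iff[THEN iffD2])
    also have "\<dots> \<le> 32 * X" using pv X1 by linarith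
    finally have "2 ^ (L - 1) < 32 * X" by simp
    moreover have "L - 1 = (L - 6) + 5" using False by simp
    then have "(2::real) ^ (L - 1) = 2 ^ (L - 6) * 32" by (simp only: power_add) simp
    ultimately have "2 ^ (L - 6) < X" by linarith
    then have "ln (2 ^ (L - 6)) < ln X" using X1 by (subst ln_less_cancel_iff) auto
    then have "real (L - 6) * ln 2 < f" using f1 by (simp add: ln_realpow)
    moreover have "exp 1 \<le> (2::real) ^ 2" using exp_le by simp
    then have "1 \<le> ln ((2::real) ^ 2)" by (subst ln_ge_iff) auto
    then have "1 / 2 \<le> ln (2::real)" unfolding ln_realpow by simp
    then have "real (L - 6) * (1 / 2) \<le> real (L - 6) * ln 2"
      by (intro mult_left_mono) auto
    moreover have "real (L - 6) = real L - 6" using False by (simp add: of_nat_diff)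
    ultimately show ?thesis using f1 by linarith
  qed
  have k\<phi>: "real k \<le> 5 / 2 * (1 / \<phi>)" using \<phi> k by (simp add: field_simps)
  have \<phi>1: "1 \<le> 1 / \<phi>" using \<phi> by simp
  \<comment> \<open>The estimate of the phases below has a single logarithmic factor; f \<ge> 1
    supplies the second one.\<close>
  have ff: "f \<le> f\<^sup>2" using f1 by (simp add: power2_eq_square)
  have XX: "X \<le> X / \<phi>" using mult_left_mono[OF \<phi>1, of X] X1 by simp
  have Y1: "X / \<phi> * f \<le> Y" unfolding Y_def using ff XX X1 by (intro mult_left_mono) auto
  have Y2: "X * f \<le> X / \<phi> * f" using XX f1 by (intro mult_right_mono) auto
  have Y3: "X * 1 \<le> X * f" "1 * f \<le> X * f" using X1 f1 by (auto intro!: mult_left_mono mult_right_mono)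
  have Y: "X \<le> Y" "f \<le> Y" "1 \<le> Y" using Y1 Y2 Y3 X1 by linarith+
  have "real k * ((real L + 1) * (real (p * v) + 1)) \<le> (5 / 2 * (1 / \<phi>)) * ((9 * f) * (25 * X))"
    using k\<phi> Lf pv X1 f1 \<phi> by (intro mult_mono) auto
  also have "\<dots> = 1125 / 2 * (X / \<phi> * f)" by simp
  finally have main: "real k * ((real L + 1) * (real (p * v) + 1)) \<le> 1125 / 2 * Y" using Y1 by linarith
  have "real t \<le> real (100 * n + 50 * p + 50 * L + 800000 * (k * ((L + 1) * (p * v + 1))) + 300)"
    using t by (rule of_nat_mono)
  also have "\<dots> = 100 * real n + 50 * real p + 50 * real L
      + 800000 * (real k * ((real L + 1) * (real (p * v) + 1))) + 300"
    by (simp add: algebra_simps)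
  also have "\<dots> \<le> 500000000 * (Y + real m)"
  proof -
    have "real n \<le> real v + real m" using n by linarith
    then have "real n \<le> Y + real m" using vX Y by linarith
    moreover have "real L \<le> 9 * Y" using Lf Y by linarith
    moreover have "real p \<le> 24 * Y" using pX Y by linarith
    moreover have "0 \<le> real m" by simp
    ultimately show ?thesis using main Y(3) unfolding distrib_left by linarith
  qed
  finally show ?thesis by (simp add: Y_def X_def f_def)
qed

context local_graph begin

lemma vol_filter:
  "finite A \<Longrightarrow> vol E ({v \<in> A. 0 < degree E v} \<inter> X) = vol E (A \<inter> X)"
  unfolding vol_def by (rule sum.mono_neutral_left) auto

text \<open>The target set does not occur: the run depends only on the input, and the certificate of
  success speaks of all sets X. The numbers p, L and k are exposed because the approximation ratio
  and the running time are computed from them afterwards.\<close>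

lemma local_improve_correct:
  assumes as: "set as \<subseteq> V" "distinct as" "0 < vol E (set as)" "vol E (set as) \<le> vol E (V - set as)"
    and \<sigma>: "0 < \<sigma>" "\<sigma> \<le> 1" "3 * (1 / \<sigma> - 1) \<le> real (vol E (V - set as)) / real (vol E (set as))"
  shows "\<exists>t s p L k S. exec adj local_improve (initial_state as \<sigma>) t s \<and>
    16 \<le> p \<and> 24 < (real p + 17) * \<sigma> \<and> (p = 16 \<or> (real p + 16) * \<sigma> \<le> 24) \<and>
    (L = 0 \<or> 2 ^ (L - 1) < p * vol E (set as)) \<and> 0 < k \<and>
    S \<subseteq> V \<and> output_set s S \<and> 0 < vol E S \<and> 0 < vol E (V - S) \<and> 8 * vol E S \<le> p * vol E (set as) \<and>
    (conductance V E S = 0 \<or> conductance V E S \<le> 5 / (2 * real k) \<and>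
      (\<forall>X\<subseteq>V. real p * vol E (set as \<inter> X) \<le> 8 * real (vol E X) + (real p - 8) * real k * cut X (V - X))) \<and>
    t \<le> 100 * length as + 50 * p + 50 * L + 800000 * (k * ((L + 1) * (p * vol E (set as) + 1))) + 300"
proof -
  let ?s0 = "initial_state as \<sigma>"
  define bs where "bs = filter (\<lambda>v. 0 < degree E v) as"
  have vol_bs: "vol E (set bs \<inter> X) = vol E (set as \<inter> X)" for X
    unfolding bs_def set_filter by (rule vol_filter) simp
  from vol_bs[of UNIV] have vol_bs': "vol E (set bs) = vol E (set as)" by simp
  have "(\<Sum>v\<leftarrow>bs. degree E v) = vol E (set bs)"
    unfolding vol_def using as(2) by (simp add: bs_def sum_list_distinct_conv_sum_set)
  then have sum_bs: "(\<Sum>v\<leftarrow>bs. degree E v) = vol E (set as)" using vol_bs' by simp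

  have "wp adj read_input (\<lambda>T' s'. vars s' ''nb'' = real (length bs) \<and>
     (\<forall>i<length bs. arrs s' ''B'' i = real (bs ! i)) \<and> vars s' ''vA'' = real (\<Sum>v\<leftarrow>bs. degree E v) \<and>
     (\<forall>i<length as. arrs s' ''S'' i = real (as ! i)) \<and> T' \<le> 0 + 100 * length as + 10) 0 ?s0"
    unfolding bs_def by (rule read_input_correct[OF as(1)]) (simp_all add: initial_state_def)
  then obtain t1 s1 where e1: "exec adj read_input ?s0 t1 s1" and
    q1: "vars s1 ''nb'' = real (length bs)" "\<forall>i<length bs. arrs s1 ''B'' i = real (bs ! i)"
      "vars s1 ''vA'' = real (vol E (set as))" "\<forall>i<length as. arrs s1 ''S'' i = real (as ! i)"
      "t1 \<le> 100 * length as + 10"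
    unfolding wp_def sum_bs by auto
  have f1: "vars s1 ''A'' = real (length as)" "vars s1 ''sigma'' = \<sigma>" "vars s1 ''L'' = 0"
    "\<forall>a\<in>{''l'', ''cur'', ''ab'', ''inj'', ''g''}. arrs s1 a = (\<lambda>i. 0)"
    using exec_frame[OF e1] by (simp_all add: frame_def read_input_def read_body_def incr_def initial_state_def)

  define s2 where "s2 = s1\<lparr>vars := (vars s1)(''S'' := real (length as), ''p'' := 16)\<rparr>"
  have "wp adj (Assign ''S'' (Var ''A'') ;; Assign ''p'' (Const 16)) (\<lambda>t s. t \<le> 10 \<and> s = s2) 0 s1"
    using f1 by (simp add: wp_simps s2_def)
  then obtain t2 where e2: "exec adj (Assign ''S'' (Var ''A'') ;; Assign ''p'' (Const 16)) s1 t2 s2" "t2 \<le> 10"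
    unfolding wp_def by auto

  have "wp adj find_p (\<lambda>T' s'. \<exists>p. vars s' ''p'' = real p \<and> 16 \<le> p \<and> 24 < (real p + 17) * \<sigma> \<and>
     (p = 16 \<or> (real p + 16) * \<sigma> \<le> 24) \<and> T' \<le> 0 + 50 * p) 0 s2"
    by (rule find_p_correct) (use f1 \<sigma> in \<open>simp_all add: s2_def\<close>)
  then obtain t3 s3 p where e3: "exec adj find_p s2 t3 s3" and
    p: "vars s3 ''p'' = real p" "16 \<le> p" "24 < (real p + 17) * \<sigma>" "p = 16 \<or> (real p + 16) * \<sigma> \<le> 24" "t3 \<le> 50 * p"
    unfolding wp_def by auto
  have f3: "vars s3 x = vars s2 x" if "x \<noteq> ''p''" for x
    using exec_frame[OF e3] that by (simp add: frame_def find_p_def incr_def)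
  have a3: "arrs s3 a = arrs s1 a" for a
    using exec_frame[OF e3] by (simp add: frame_def find_p_def incr_def s2_def)

  define s4 where "s4 = s3\<lparr>vars := (vars s3)(''w'' := 1)\<rparr>"
  have "wp adj (Assign ''w'' (Const 1)) (\<lambda>t s. t \<le> 10 \<and> s = s4) 0 s3"
    by (simp add: wp_simps s4_def)
  then obtain t4 where e4: "exec adj (Assign ''w'' (Const 1)) s3 t4 s4" "t4 \<le> 10"
    unfolding wp_def by auto

  have "wp adj find_L (\<lambda>T' s'. \<exists>L. vars s' ''L'' = real L \<and> p * vol E (set as) \<le> 2 ^ L \<and>
     (L = 0 \<or> 2 ^ (L - 1) < p * vol E (set as)) \<and> T' \<le> 0 + 50 * L + 20) 0 s4"
    by (rule find_L_correct) (use f1 f3 p q1 in \<open>simp_all add: s4_def s2_def\<close>)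
  then obtain t5 s5 L where e5: "exec adj find_L s4 t5 s5" and
    L: "vars s5 ''L'' = real L" "p * vol E (set as) \<le> 2 ^ L" "L = 0 \<or> 2 ^ (L - 1) < p * vol E (set as)"
      "t5 \<le> 50 * L + 20"
    unfolding wp_def by auto
  have f5: "vars s5 x = vars s4 x" if "x \<noteq> ''L''" "x \<noteq> ''w''" for x
    using exec_frame[OF e5] that by (simp add: frame_def find_L_def find_L_body_def incr_def)
  have a5: "arrs s5 a = arrs s1 a" for a
    using exec_frame[OF e5] a3 by (simp add: frame_def find_L_def find_L_body_def incr_def s4_def)

  define s6 where "s6 = s5\<lparr>vars := (vars s5)(''k'' := 1, ''go'' := 1)\<rparr>"
  have "wp adj (Assign ''k'' (Const 1) ;; Assign ''go'' (Const 1)) (\<lambda>t s. t \<le> 10 \<and> s = s6) 0 s5"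
    by (simp add: wp_simps s6_def)
  then obtain t6 where e6: "exec adj (Assign ''k'' (Const 1) ;; Assign ''go'' (Const 1)) s5 t6 s6" "t6 \<le> 10"
    unfolding wp_def by auto

  let ?vA = "vol E (set as)" let ?vB = "vol E (V - set as)"
  have vV: "vol E V = ?vA + ?vB"
    using vol_Int_Diff[OF finite_V, of "set as"] as(1) by (simp add: Int_absorb1)
  \<comment> \<open>Here the hypothesis on \<sigma> enters: it bounds 24 vol(A) / \<sigma> - 16
    vol(A) by 8 vol(V - A) + 8 vol(A).\<close>
  have small: "p * ?vA \<le> 8 * vol E V"
  proof (cases "p = 16")
    case True
    then show ?thesis using vV as(4) by simp
  next
    case False
    then have "real p + 16 \<le> 24 / \<sigma>" using p(4) \<sigma>(1) by (simp add: le_divide_eq)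
    then have "(real p + 16) * ?vA \<le> 24 / \<sigma> * ?vA" by (intro mult_right_mono) auto
    then have "real (p * ?vA) + 16 * real ?vA \<le> 24 * (?vA / \<sigma>)" by (simp add: distrib_right)
    moreover have "3 * (1 / \<sigma> - 1) * ?vA \<le> ?vB"
      using \<sigma>(3) as(3) by (simp add: le_divide_eq)
    then have "3 * (?vA / \<sigma>) - 3 * real ?vA \<le> ?vB" by (simp add: algebra_simps)
    moreover have "real (8 * vol E V) = 8 * real ?vA + 8 * real ?vB" unfolding vV by simp
    ultimately have "real (p * ?vA) \<le> real (8 * vol E V)" by linarith
    then show ?thesis by (simp only: of_nat_le_iff)
  qed
  interpret I: improve V E adj bs p L
  proof unfold_locales
    show "distinct bs" "set bs \<subseteq> V" "\<And>v. v \<in> set bs \<Longrightarrow> 0 < degree E v"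
      using as by (auto simp: bs_def)
    show "16 \<le> p" "p * vol E (set bs) \<le> 2 ^ L" "p * vol E (set bs) \<le> 8 * vol E V"
      using p(2) L(2) small vol_bs' by simp_all
  qed
  have "I.main_inv 1 s6"
    unfolding I.main_inv_def
  proof (intro conjI exI[of _ "set as"])
    show "I.ready s6"
      unfolding I.ready_def using q1 p(1) L(1) f5 f3 a5 vol_bs' by (simp add: s6_def s4_def s2_def)
    show "vars s6 ''k'' = real 1" by (simp add: s6_def)
    show "zeroed (Suc 1) s6" using f1(4) a5 by (simp add: zeroed_def s6_def)
    show "output_set s6 (set as)"
      unfolding output_set_def using as(2) q1(4) a5 f5 f3
      by (intro exI[of _ as]) (simp add: s6_def s4_def s2_def)
    show "0 < vol E (V - set as)" using as(3,4) by simp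
    have "16 * ?vA \<le> p * ?vA" using p(2) by (rule mult_le_mono1)
    then show "8 * ?vA \<le> p * vol E (set bs)" unfolding vol_bs' by linarith
    have "cut (set as) (V - set as) \<le> ?vA" using cut_le_vol as(1) by blast
    then have "4 * real 1 * cut (set as) (V - set as) \<le> 5 * ?vA" "4 * real 1 * cut (set as) (V - set as) \<le> 5 * ?vB"
      using as(4) by simp_all
    then have "conductance V E (set as) \<le> 5 / (4 * real 1)"
      using I.conductance_le[of "set as" 1] as \<open>0 < vol E (V - set as)\<close> by simp
    then show "if 0 < vars s6 ''go''
      then conductance V E (set as) \<le> 5 / (4 * real 1) \<and> (1 = 1 \<or> 0 < conductance V E (set as))
      else conductance V E (set as) = 0 \<or> conductance V E (set as) \<le> 5 / (2 * real 1) \<and> I.certified 1"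
      by (simp add: s6_def)
  qed (use as in auto)
  from I.main_loop_correct[OF this, of 0]
  obtain t7 s7 k where e7: "exec adj (While (Less (Const 0) (Var ''go'')) phase) s6 t7 s7" and
    k: "I.main_inv k s7" "\<not> 0 < vars s7 ''go''"
      "t7 \<le> 800000 * (k * ((L + 1) * (p * vol E (set as) + 1))) + 10"
    unfolding wp_def vol_bs' by auto
  obtain S where S: "S \<subseteq> V" "output_set s7 S" "0 < vol E S" "0 < vol E (V - S)" "8 * vol E S \<le> p * ?vA"
    "conductance V E S = 0 \<or> conductance V E S \<le> 5 / (2 * real k) \<and> I.certified k"
    using k(1,2) unfolding I.main_inv_def vol_bs' by auto
  have k0: "0 < k" using k(1) by (simp add: I.main_inv_def)
  note e = exec.Seq[OF e1 exec.Seq[OF e2(1) exec.Seq[OF e3 exec.Seq[OF e4(1)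
    exec.Seq[OF e5 exec.Seq[OF e6(1) e7]]]]]]
  define t where "t = t1 + (t2 + (t3 + (t4 + (t5 + (t6 + t7)))))"
  have t: "t \<le> 100 * length as + 50 * p + 50 * L + 800000 * (k * ((L + 1) * (p * ?vA + 1))) + 300"
    using q1(5) e2(2) p(5) e4(2) L(4) e6(2) k(3) unfolding t_def by linarith
  show ?thesis
    by (rule exI[of _ t], rule exI[of _ s7], rule exI[of _ p], rule exI[of _ L], rule exI[of _ k],
        rule exI[of _ S])
      (intro conjI e[folded local_improve_def t_def] p(2-4) L(3) k0 S[unfolded I.certified_def vol_bs] t)
qed

end

text \<open>After the lower bound on c is inserted, the claim reduces to 5 \<delta> (p - 8) \<le> 8
  (p \<delta> - 8), that is, to 64 \<le> (3 p + 40) \<delta>. The maximality of p gives 192 < 8 (p +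
  17) \<delta>, and 8 (p + 17) \<le> 9 p + 120 holds precisely for p \<ge> 16.\<close>

lemma certified_bound:
  fixes p :: nat and \<sigma> \<delta> k v c :: real
  assumes p: "16 \<le> p" "24 < (real p + 17) * \<sigma>" and \<sigma>: "0 < \<sigma>" "\<sigma> \<le> \<delta>" and v: "0 < v" and k: "0 < k"
    and c: "real p * (\<delta> * v) \<le> 8 * v + (real p - 8) * k * c"
  shows "5 / (2 * k) \<le> 4 / \<delta> * (c / v)"
proof -
  have "8 * (real p + 17) * \<sigma> \<le> (9 * real p + 120) * \<sigma>" using p(1) \<sigma> by (intro mult_right_mono) auto
  then have "8 * ((real p + 17) * \<sigma>) \<le> (9 * real p + 120) * \<sigma>" by (simp only: mult.assoc)
  then have "192 < (9 * real p + 120) * \<sigma>" using p(2) by linarith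
  also have "\<dots> \<le> (9 * real p + 120) * \<delta>" using \<sigma> by (intro mult_left_mono) auto
  also have "\<dots> = 3 * ((3 * real p + 40) * \<delta>)" by (simp add: algebra_simps)
  finally have d: "64 < (3 * real p + 40) * \<delta>" by linarith
  have "(real p - 8) * (5 * \<delta> * v) \<le> 8 * (real p * \<delta> - 8) * v"
  proof -
    have "(real p - 8) * (5 * \<delta>) \<le> 8 * (real p * \<delta> - 8)" using d by (simp add: algebra_simps)
    then have "(real p - 8) * (5 * \<delta>) * v \<le> 8 * (real p * \<delta> - 8) * v" using v by (intro mult_right_mono) auto
    then show ?thesis by (simp only: mult.assoc)
  qed
  also have "\<dots> \<le> (real p - 8) * (8 * (k * c))" using c by (simp add: algebra_simps)
  finally have "5 * \<delta> * v \<le> 8 * (k * c)" using p(1) by simp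
  then show ?thesis using k v \<sigma> by (simp add: field_simps)
qed

theorem mainTheorem1:
  shows "\<exists>(LocalImprove :: com) (C :: real).
    \<forall>(V :: nat set) (E :: nat set set) (adj :: nat \<Rightarrow> nat list option)
      (A :: nat set) (as :: nat list) (\<sigma> :: real).
      simple_graph V E \<and> adjacency_lists V E adj \<and>
      A \<subseteq> V \<and> distinct as \<and> set as = A \<and>
      0 < vol E A \<and> vol E A \<le> vol E (V - A) \<and>
      0 < \<sigma> \<and> \<sigma> \<le> 1 \<and>
      real (vol E (V - A)) / real (vol E A) \<ge> 3 * (1 / \<sigma> - 1) \<longrightarrow>
      (\<forall>(Sstar :: nat set) (\<delta> :: real).
        Sstar \<subseteq> V \<and> 0 < vol E Sstar \<and> vol E Sstar \<le> vol E (V - Sstar) \<and>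
        real (vol E (A \<inter> Sstar)) / real (vol E Sstar) = \<delta> \<and> \<delta> \<ge> \<sigma> \<longrightarrow>
        (\<exists>(S :: nat set) (t :: nat) (s :: state).
          exec adj LocalImprove (initial_state as \<sigma>) t s \<and> output_set s S \<and>
          S \<subseteq> V \<and> 0 < vol E S \<and> 0 < vol E (V - S) \<and>
          real (vol E S) \<le> 3 / \<sigma> * real (vol E A) \<and>
          conductance V E S \<le> 4 / \<delta> * conductance V E Sstar \<and>
          (conductance V E S > 0 \<longrightarrow>
            real t \<le> C * (real (vol E A) / (\<sigma> * conductance V E S)
                            * (log_factor (real (vol E A) / \<sigma>))\<^sup>2
                          + real (card {v \<in> A. degree E v = 0})))))"
proof (rule exI[of _ local_improve], rule exI[of _ 500000000], intro allI impI, elim conjE)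
  fix V :: "nat set" and E adj A as and \<sigma> \<delta> :: real and Sstar
  assume g: "simple_graph V E" "adjacency_lists V E adj"
    and A: "A \<subseteq> V" "distinct as" "set as = A" "0 < vol E A" "vol E A \<le> vol E (V - A)"
    and \<sigma>: "0 < \<sigma>" "\<sigma> \<le> 1" "real (vol E (V - A)) / real (vol E A) \<ge> 3 * (1 / \<sigma> - 1)"
    and Sstar: "Sstar \<subseteq> V" "0 < vol E Sstar" "vol E Sstar \<le> vol E (V - Sstar)"
      "real (vol E (A \<inter> Sstar)) / real (vol E Sstar) = \<delta>" "\<delta> \<ge> \<sigma>"
  interpret local_graph V E adj using g by unfold_locales
  obtain t s p L k S where e: "exec adj local_improve (initial_state as \<sigma>) t s" and
    p: "16 \<le> p" "24 < (real p + 17) * \<sigma>" "p = 16 \<or> (real p + 16) * \<sigma> \<le> 24" and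
    L: "L = 0 \<or> 2 ^ (L - 1) < p * vol E A" and k: "0 < k" and
    S: "S \<subseteq> V" "output_set s S" "0 < vol E S" "0 < vol E (V - S)" "8 * vol E S \<le> p * vol E A" and
    cond: "conductance V E S = 0 \<or> conductance V E S \<le> 5 / (2 * real k) \<and>
      (\<forall>X\<subseteq>V. real p * vol E (A \<inter> X) \<le> 8 * real (vol E X) + (real p - 8) * real k * cut X (V - X))" and
    t: "t \<le> 100 * length as + 50 * p + 50 * L + 800000 * (k * ((L + 1) * (p * vol E A + 1))) + 300"
    using local_improve_correct[of as \<sigma>, unfolded A(3), OF A(1,2,4,5) \<sigma>]
    by (elim exE conjE) (rule that)
  have p24: "real p * \<sigma> \<le> 24" using p(3) \<sigma> by (auto simp: algebra_simps)
  have "8 * real (vol E S) \<le> real p * vol E A"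
    using of_nat_mono[OF S(5), where ?'a = real] by simp
  also have "\<dots> \<le> 24 / \<sigma> * vol E A" using p24 \<sigma> by (intro mult_right_mono) (simp_all add: le_divide_eq)
  finally have vol: "real (vol E S) \<le> 3 / \<sigma> * vol E A" by simp
  have c0: "0 \<le> conductance V E Sstar" by (simp add: conductance_def)
  have \<delta>: "0 < \<delta>" using \<sigma> Sstar by linarith
  have quality: "conductance V E S \<le> 4 / \<delta> * conductance V E Sstar"
  proof (cases "conductance V E S = 0")
    case True
    then show ?thesis using c0 \<delta> by simp
  next
    case False
    then have c: "conductance V E S \<le> 5 / (2 * real k)"
      "real p * vol E (A \<inter> Sstar) \<le> 8 * real (vol E Sstar) + (real p - 8) * real k * cut Sstar (V - Sstar)"
      using cond Sstar(1) by auto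
    have "real (vol E (A \<inter> Sstar)) = \<delta> * vol E Sstar" using Sstar(2,4) by (simp add: field_simps)
    then have "5 / (2 * real k) \<le> 4 / \<delta> * (cut Sstar (V - Sstar) / vol E Sstar)"
      using certified_bound[OF p(1,2) \<sigma>(1) Sstar(5)] c(2) Sstar(2) k by simp
    also have "cut Sstar (V - Sstar) / vol E Sstar = conductance V E Sstar"
      using Sstar(3) by (simp add: conductance_cut[OF Sstar(1)] min_def)
    finally show ?thesis using c(1) by linarith
  qed
  have len: "length as \<le> vol E A + card {v \<in> A. degree E v = 0}"
  proof -
    have fin: "finite A" using A(3) by auto
    have "length as = card A" using A(2,3) distinct_card by metis
    also have "\<dots> = (\<Sum>v\<in>A. 1)" by simp
    also have "\<dots> \<le> (\<Sum>v\<in>A. degree E v + (if degree E v = 0 then 1 else 0))" by (intro sum_mono) auto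
    also have "\<dots> = vol E A + card {v \<in> A. degree E v = 0}"
      using fin by (simp add: sum.distrib vol_def sum.If_cases Int_def)
    finally show ?thesis .
  qed
  \<comment> \<open>Conductance at most 1 lets the terms of order vol(A) / \<sigma> in the running
    time be absorbed by their quotient with the conductance.\<close>
  have "conductance V E S \<le> 1"
  proof -
    have "cut S (V - S) \<le> vol E S" "cut S (V - S) \<le> vol E (V - S)"
      using cut_le_vol[of S "V - S"] cut_le_vol[of "V - S" S] cut_commute[of S "V - S"] S(1) by simp_all
    then show ?thesis using S by (simp add: conductance_cut divide_le_eq)
  qed
  then have "real t \<le> 500000000 * (real (vol E A) / (\<sigma> * conductance V E S)
       * (log_factor (real (vol E A) / \<sigma>))\<^sup>2 + real (card {v \<in> A. degree E v = 0}))"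
    if "0 < conductance V E S"
    using time_bound[OF \<sigma>(1,2) A(4) p24 L that _ _ k len t] cond that by auto
  then show "\<exists>(S :: nat set) (t :: nat) (s :: state).
          exec adj local_improve (initial_state as \<sigma>) t s \<and> output_set s S \<and>
          S \<subseteq> V \<and> 0 < vol E S \<and> 0 < vol E (V - S) \<and>
          real (vol E S) \<le> 3 / \<sigma> * real (vol E A) \<and>
          conductance V E S \<le> 4 / \<delta> * conductance V E Sstar \<and>
          (conductance V E S > 0 \<longrightarrow>
            real t \<le> 500000000 * (real (vol E A) / (\<sigma> * conductance V E S)
                            * (log_factor (real (vol E A) / \<sigma>))\<^sup>2
                          + real (card {v \<in> A. degree E v = 0})))"
    using e S vol quality by blast
qed

end
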